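(* Let $G=(V,E)$ be a simple undirected unweighted graph, $V=\{1,\dots,n\}$. The following three statements are equivalent: (a) $G$ is bipartite; (b) the spectra of $\Delta_1^+$ and $\Delta_1$ coincide (counting $\gamma$-multiplicity); (c) the min-max eigenvalues of $\Delta_1^+$ agree with those of $\Delta_1$, i.e. $c_k^+=c_k$ for all $k\in\{1,\dots,n\}$.
   Context: $d_i$ is the degree of vertex $i$. For $\vec x\in\mathbb R^n$: $I(\vec x)=\sum_{\{i,j\}\in E}|x_i-x_j|$, $I^+(\vec x)=\sum_{\{i,j\}\in E}|x_i+x_j|$, $\|\vec x\|=\sum_{i\in V}d_i|x_i|$, $X=\{\vec x\in\mathbb R^n:\|\vec x\|=1\}$. $\partial$ is the convex subdifferential; $\partial\|\vec x\|=\prod_i d_i\mathrm{Sgn}(x_i)$ with $\mathrm{Sgn}(t)=\{1\}$ for $t>0$, $\{-1\}$ for $t<0$, $[-1,1]$ for $t=0$. $(\mu,\vec x)\in\mathbb R\times X$ is an eigenpair of the 1-Laplacian $\Delta_1$ if $\partial I(\vec x)\cap\mu\,\partial\|\vec x\|\ne\emptyset$, and an eigenpair of the signless 1-Laplacian $\Delta_1^+$ if $\partial I^+(\vec x)\cap\mu\,\partial\|\vec x\|\neq\emptyset$; $\mu$ is then called an eigenvalue. For a nonempty symmetric set $T\subset X$ (i.e. $-T=T$) the Krasnoselskii genus is $\gamma(T)=\min\{k\in\mathbb Z^+:\text{there is an odd continuous map } T\to\mathbb S^{k-1}\}$. The $\gamma$-multiplicity of an eigenvalue $\mu$ of $\Delta_1$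 (resp. $\Delta_1^+$) is $\gamma(K_\mu)$, where $K_\mu$ is the set of all $\vec x\in X$ such that $(\mu,\vec x)$ is an eigenpair of $\Delta_1$ (resp. $\Delta_1^+$). For $k=1,\dots,n$, $c_k^+=\inf_{\gamma(T)\ge k}\max_{\vec x\in T}I^+(\vec x)$ and $c_k=\inf_{\gamma(T)\ge k}\max_{\vec x\in T}I(\vec x)$, where $T$ ranges over nonempty symmetric subsets of $X$ with $\gamma(T)\ge k$. *)

theory Defs
  imports "HOL-Analysis.Analysis" "HOL-Library.Extended_Real"
begin

section \<open>Simple graphs on a finite vertex type\<close>

text \<open>The vertex set is all of \<open>'n\<close>, so that vertex functions are vectors of type \<open>real ^ 'n\<close>;
  a graph is given by its set of edges.\<close>

definition simple_graph :: "'n::finite set set \<Rightarrow> bool" where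
  "simple_graph E \<longleftrightarrow> (\<forall>e\<in>E. \<exists>i j. i \<noteq> j \<and> e = {i, j})"

definition bipartite :: "'n::finite set set \<Rightarrow> bool" where
  "bipartite E \<longleftrightarrow>
     (\<exists>A B. A \<union> B = UNIV \<and> A \<inter> B = {} \<and> (\<forall>e\<in>E. \<exists>a\<in>A. \<exists>b\<in>B. e = {a, b}))"

definition vdegree :: "'n::finite set set \<Rightarrow> 'n \<Rightarrow> nat" where
  "vdegree E i = card {e \<in> E. i \<in> e}"

section \<open>The functionals\<close>

text \<open>An edge \<open>{i, j}\<close> of a simple graph arises from exactly the two ordered pairs \<open>(i, j)\<close> and
  \<open>(j, i)\<close>; this is the reason for the factor \<open>1/2\<close>.\<close>

definition tv :: "'n::finite set set \<Rightarrow> real ^ 'n \<Rightarrow> real" where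
  "tv E x = (\<Sum>(i, j) | {i, j} \<in> E. \<bar>x $ i - x $ j\<bar>) / 2"

definition tv_plus :: "'n::finite set set \<Rightarrow> real ^ 'n \<Rightarrow> real" where
  "tv_plus E x = (\<Sum>(i, j) | {i, j} \<in> E. \<bar>x $ i + x $ j\<bar>) / 2"

definition wnorm :: "'n::finite set set \<Rightarrow> real ^ 'n \<Rightarrow> real" where
  "wnorm E x = (\<Sum>i\<in>UNIV. real (vdegree E i) * \<bar>x $ i\<bar>)"

definition wsphere :: "'n::finite set set \<Rightarrow> (real ^ 'n) set" where
  "wsphere E = {x. wnorm E x = 1}"

section \<open>Eigenpairs\<close>

definition subdifferential :: "('a::real_inner \<Rightarrow> real) \<Rightarrow> 'a \<Rightarrow> 'a set" where
  "subdifferential f x = {s. \<forall>y. f x + s \<bullet> (y - x) \<le> f y}"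

text \<open>The functional \<open>F\<close> below is \<open>tv E\<close> for the 1-Laplacian and \<open>tv_plus E\<close> for the signless
  1-Laplacian.\<close>

definition eigenpair ::
    "'n::finite set set \<Rightarrow> (real ^ 'n \<Rightarrow> real) \<Rightarrow> real \<Rightarrow> real ^ 'n \<Rightarrow> bool" where
  "eigenpair E F \<mu> x \<longleftrightarrow>
     x \<in> wsphere E \<and>
     subdifferential F x \<inter> (\<lambda>s. \<mu> *\<^sub>R s) ` subdifferential (wnorm E) x \<noteq> {}"

definition eigenset ::
    "'n::finite set set \<Rightarrow> (real ^ 'n \<Rightarrow> real) \<Rightarrow> real \<Rightarrow> (real ^ 'n) set" where
  "eigenset E F \<mu> = {x. eigenpair E F \<mu> x}"

definition spectrum1 :: "'n::finite set set \<Rightarrow> (real ^ 'n \<Rightarrow> real) \<Rightarrow> real set" where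
  "spectrum1 E F = {\<mu>. \<exists>x. eigenpair E F \<mu> x}"

section \<open>Krasnoselskii genus\<close>

text \<open>\<open>nsphere (k - 1)\<close> is the unit sphere of \<open>k\<close>-dimensional Euclidean space, whose points are
  functions \<open>nat \<Rightarrow> real\<close> vanishing from index \<open>k\<close> on.\<close>

definition odd_map_to_sphere :: "'a::real_normed_vector set \<Rightarrow> nat \<Rightarrow> bool" where
  "odd_map_to_sphere T k \<longleftrightarrow>
     (\<exists>f. continuous_map (top_of_set T) (nsphere (k - 1)) f \<and>
          (\<forall>x\<in>T. f (- x) = (\<lambda>i. - f x i)))"

text \<open>The minimum exists for every symmetric \<open>T\<close> in \<open>real ^ 'n\<close> with \<open>0 \<notin> T\<close> (normalise), in
  particular for all \<open>T \<subseteq> wsphere E\<close>, the only sets to which the genus is applied.\<close>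

definition genus :: "'a::real_normed_vector set \<Rightarrow> nat" where
  "genus T = (LEAST k. 1 \<le> k \<and> odd_map_to_sphere T k)"

definition multiplicity_genus ::
    "'n::finite set set \<Rightarrow> (real ^ 'n \<Rightarrow> real) \<Rightarrow> real \<Rightarrow> nat" where
  "multiplicity_genus E F \<mu> = genus (eigenset E F \<mu>)"

section \<open>Min-max values\<close>

text \<open>The maximum over \<open>T\<close> is read as a supremum, as \<open>T\<close> need not be compact. Passing to the closure
  of \<open>T\<close> changes neither the supremum nor the admissibility of \<open>T\<close>, so this agrees with letting \<open>T\<close>
  range over closed sets. If there are isolated vertices, no \<open>T\<close> is admissible for large \<open>k\<close>, and
  the value is then \<open>\<infinity>\<close>, the infimum of the empty set; hence the type \<^typ>\<open>ereal\<close>.\<close>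

definition minmax ::
    "'n::finite set set \<Rightarrow> (real ^ 'n \<Rightarrow> real) \<Rightarrow> nat \<Rightarrow> ereal" where
  "minmax E F k =
     (INF T \<in> {T. T \<noteq> {} \<and> T \<subseteq> wsphere E \<and> uminus ` T = T \<and> k \<le> genus T}.
        SUP x \<in> T. ereal (F x))"

end

theory Submission
  imports Defs "HOL-Homology.Invariance_of_Domain"
begin

text \<open>If the graph is bipartite, changing the sign of all coordinates on one side of the bipartition
is a linear isometry that preserves the weighted norm and turns \<open>I\<^sup>+\<close> into \<open>I\<close>. It carries
eigensets to eigensets and admissible sets of the min-max problem to admissible sets, and it
preserves the genus, so all invariants agree (\<open>bipartite_imp_same_invariants\<close>).

For the converse it suffices to look at the value 0. Let \<open>N\<close> and \<open>N\<^sup>+\<close> be the spaces of zeros of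
\<open>I\<close> and \<open>I\<^sup>+\<close> among the vectors that vanish at the isolated vertices (\<open>null_space\<close>). The eigenset
of the eigenvalue 0 is, up to the isolated coordinates, the unit sphere of \<open>N\<close> or \<open>N\<^sup>+\<close> for the
weighted norm, and its genus is the dimension of that space (\<open>genus_eigenset_0\<close>). By a compactness
argument, the \<open>k\<close>-th min-max value is at most 0 exactly if \<open>k\<close> does not exceed that dimension
(\<open>minmax_le_0_iff\<close>). Hence equal multiplicities as well as equal min-max values force
\<open>dim N \<le> dim N\<^sup>+\<close>, and this inequality makes the graph bipartite (\<open>bipartite_if_dim_le\<close>): multiplying
pointwise by a vector \<open>w\<close> of maximal support in \<open>N\<^sup>+\<close> embeds \<open>N\<^sup>+\<close> into \<open>N\<close>, and it misses the
indicator of the set of vertices that are not isolated unless \<open>w\<close> vanishes at isolated vertices only,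
in which case the signs of \<open>w\<close> are a bipartition.

That the genus of the sphere of a \<open>k\<close>-dimensional space is at least \<open>k\<close> is the Borsuk-Ulam theorem
(\<open>Borsuk_Ulam_flat_sphere\<close>). It follows from the fact that odd self-maps of spheres have odd degree
(\<open>odd_degree_of_odd_map\<close>), which is proved by induction on the dimension from
\<open>Borsuk_odd_mapping_degree_step\<close>.\<close>

section \<open>Spheres in the coordinate subspaces of a Euclidean space\<close>

text \<open>The spheres \<open>nsphere m\<close> of different dimensions live in one type of sequences, whereas
polynomial approximation and Lebesgue null sets belong to Euclidean spaces. A fixed
enumeration of the basis lets all spheres of dimension below \<open>DIM('a)\<close> be treated as sections
\<open>flat_sphere k\<close> of the unit sphere of one type \<open>'a\<close>, so that an induction on the dimension
stays inside that type.\<close>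

definition basis_vec :: "nat \<Rightarrow> 'a::euclidean_space" where
  "basis_vec = (SOME b. bij_betw b {..<DIM('a)} Basis)"

definition coords :: "'a::euclidean_space \<Rightarrow> nat \<Rightarrow> real" where
  "coords x i = (if i < DIM('a) then x \<bullet> basis_vec i else 0)"

definition of_coords :: "(nat \<Rightarrow> real) \<Rightarrow> 'a::euclidean_space" where
  "of_coords y = (\<Sum>i<DIM('a). y i *\<^sub>R basis_vec i)"

definition flat :: "nat \<Rightarrow> 'a::euclidean_space set" where
  "flat k = {x. \<forall>i\<ge>k. coords x i = 0}"

definition flat_sphere :: "nat \<Rightarrow> 'a::euclidean_space set" where
  "flat_sphere k = sphere 0 1 \<inter> flat k"

lemma bij_basis_vec: "bij_betw (basis_vec :: nat \<Rightarrow> 'a::euclidean_space) {..<DIM('a)} Basis"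
proof -
  have "\<exists>b. bij_betw b {..<DIM('a)} (Basis :: 'a set)"
    using ex_bij_betw_nat_finite[OF finite_Basis] by (simp add: lessThan_atLeast0)
  then show ?thesis
    unfolding basis_vec_def by (rule someI_ex)
qed

lemma sum_basis_vec: "(\<Sum>i<DIM('a). g (basis_vec i)) = (\<Sum>b\<in>Basis. g (b :: 'a::euclidean_space))"
  by (rule sum.reindex_bij_betw[OF bij_basis_vec])

lemma basis_vec_in_Basis [simp]: "i < DIM('a) \<Longrightarrow> (basis_vec i :: 'a::euclidean_space) \<in> Basis"
  using bij_betwE[OF bij_basis_vec] by auto

lemma inner_basis_vec:
  assumes "i < DIM('a)" "j < DIM('a)"
  shows "(basis_vec i :: 'a::euclidean_space) \<bullet> basis_vec j = (if i = j then 1 else 0)"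
proof -
  have "(basis_vec i :: 'a) = basis_vec j \<longleftrightarrow> i = j"
    using bij_betw_imp_inj_on[OF bij_basis_vec] assms by (auto simp: inj_on_def)
  then show ?thesis
    using assms by (simp add: inner_Basis)
qed

lemma coords_of_coords: "coords (of_coords y :: 'a::euclidean_space) i = (if i < DIM('a) then y i else 0)"
  by (simp add: coords_def of_coords_def inner_sum_left inner_basis_vec sum.delta if_distrib cong: if_cong)

lemma of_coords_coords [simp]: "of_coords (coords x) = (x :: 'a::euclidean_space)"
proof -
  have "(of_coords (coords x) :: 'a) = (\<Sum>i<DIM('a). (x \<bullet> basis_vec i) *\<^sub>R basis_vec i)"
    by (simp add: of_coords_def coords_def)
  also have "\<dots> = x"
    using sum_basis_vec[of "\<lambda>b. (x \<bullet> b) *\<^sub>R b"] by (simp add: euclidean_representation)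
  finally show ?thesis .
qed

lemma norm_coords: "(norm (x :: 'a::euclidean_space))\<^sup>2 = (\<Sum>i<DIM('a). (coords x i)\<^sup>2)"
  unfolding power2_norm_eq_inner euclidean_inner[of x x]
  using sum_basis_vec[of "\<lambda>b. (x \<bullet> b)\<^sup>2"]
  by (simp add: coords_def power2_eq_square)

lemma coords_arith [simp]:
  "coords 0 i = 0"
  "coords (x + y) i = coords x i + coords y i"
  "coords (x - y) i = coords x i - coords y i"
  "coords (- x) i = - coords x i"
  "coords (c *\<^sub>R x) i = c * coords x i"
  by (auto simp: coords_def inner_simps)

lemma of_coords_minus: "of_coords (\<lambda>i. - y i) = - of_coords y"
  by (simp add: of_coords_def sum_negf)

lemma subspace_flat [simp]: "subspace (flat k)"
  by (auto simp: flat_def subspace_def)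

lemma flat_mono: "j \<le> k \<Longrightarrow> flat j \<subseteq> flat k"
  by (auto simp: flat_def)

lemma flat_sphere_mono: "j \<le> k \<Longrightarrow> flat_sphere j \<subseteq> flat_sphere k"
  using flat_mono by (auto simp: flat_sphere_def)

lemma coords_basis_vec:
  "i < DIM('a) \<Longrightarrow> coords (basis_vec i :: 'a::euclidean_space) j = (if i = j then 1 else 0)"
  by (auto simp: coords_def inner_basis_vec)

lemma basis_vec_in_flat_sphere:
  assumes "i < k" "i < DIM('a)"
  shows "(basis_vec i :: 'a::euclidean_space) \<in> flat_sphere k"
  using assms by (auto simp: flat_sphere_def flat_def coords_basis_vec)

lemma basis_vec_notin_flat: "i < DIM('a) \<Longrightarrow> (basis_vec i :: 'a::euclidean_space) \<notin> flat i"
  by (auto simp: flat_def coords_basis_vec)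

lemma flat_sphere_minus: "- x \<in> flat_sphere k \<longleftrightarrow> x \<in> flat_sphere k"
  by (auto simp: flat_sphere_def flat_def)

lemma normalize_in_flat_sphere:
  "x \<in> flat k \<Longrightarrow> x \<noteq> 0 \<Longrightarrow> x /\<^sub>R norm x \<in> flat_sphere k"
  by (auto simp: flat_sphere_def subspace_scale)

lemma compact_flat_sphere: "compact (flat_sphere k)"
  unfolding flat_sphere_def
  by (intro compact_Int_closed compact_sphere closed_subspace subspace_flat)

lemma coords_in_nsphere:
  assumes "m < DIM('a)" "(x :: 'a::euclidean_space) \<in> flat_sphere (Suc m)"
  shows "coords x \<in> topspace (nsphere m)"
proof -
  have "(\<Sum>i<DIM('a). (coords x i)\<^sup>2) = (\<Sum>i\<le>m. (coords x i)\<^sup>2)"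
    by (rule sum.mono_neutral_right) (use assms in \<open>auto simp: flat_sphere_def flat_def\<close>)
  moreover have "norm x = 1" using assms by (auto simp: flat_sphere_def)
  ultimately show ?thesis
    using assms norm_coords[of x] by (auto simp: nsphere flat_sphere_def flat_def)
qed

lemma coords_of_coords_nsphere:
  assumes "m < DIM('a)" "y \<in> topspace (nsphere m)"
  shows "coords (of_coords y :: 'a::euclidean_space) = y"
  using assms by (auto simp: coords_of_coords nsphere fun_eq_iff)

lemma of_coords_in_flat_sphere:
  assumes "m < DIM('a)" "y \<in> topspace (nsphere m)"
  shows "(of_coords y :: 'a::euclidean_space) \<in> flat_sphere (Suc m)"
proof -
  let ?x = "of_coords y :: 'a"
  have c: "coords ?x = y" using assms by (rule coords_of_coords_nsphere)
  have "(\<Sum>i<DIM('a). (y i)\<^sup>2) = (\<Sum>i\<le>m. (y i)\<^sup>2)"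
    by (rule sum.mono_neutral_right) (use assms in \<open>auto simp: nsphere\<close>)
  then have "(norm ?x)\<^sup>2 = 1"
    using norm_coords[of ?x] assms c by (simp add: nsphere)
  then have "norm ?x = 1"
    by (simp add: power2_eq_1_iff) (smt (verit) norm_ge_zero)
  then show ?thesis
    using assms c by (auto simp: flat_sphere_def flat_def nsphere)
qed

lemma continuous_map_coords:
  assumes "m < DIM('a)"
  shows "continuous_map (top_of_set (flat_sphere (Suc m) :: 'a::euclidean_space set)) (nsphere m) coords"
proof -
  have "continuous_on X (\<lambda>x::'a. coords x i)" for X i
    by (cases "i < DIM('a)") (auto simp: coords_def intro!: continuous_intros)
  then show ?thesis
    unfolding nsphere continuous_map_in_subtopology
    using coords_in_nsphere[OF assms]
    by (auto simp: nsphere continuous_map_componentwise_UNIV)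
qed

lemma continuous_map_of_coords:
  assumes "m < DIM('a)"
  shows "continuous_map (nsphere m) (top_of_set (flat_sphere (Suc m) :: 'a::euclidean_space set)) of_coords"
proof -
  have "continuous_on X (\<lambda>y. of_coords y :: 'a)" for X
    unfolding of_coords_def
    by (intro continuous_intros continuous_on_product_then_coordinatewise[where f="\<lambda>y. y"])
  then have "continuous_map (nsphere m) euclidean (\<lambda>y. of_coords y :: 'a)"
    by (simp add: nsphere euclidean_product_topology)
  then show ?thesis
    using of_coords_in_flat_sphere[OF assms]
    by (auto simp: continuous_map_in_subtopology)
qed

section \<open>Degrees of self-maps of spheres\<close>

text \<open>Only for \<open>m < DIM('a)\<close> and a self-map \<open>G\<close> of \<open>flat_sphere (Suc m)\<close> is this the Brouwer
degree of \<open>G\<close>. The index follows \<open>nsphere m\<close>, whose ambient dimension is \<open>Suc m\<close>.\<close>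

definition flat_sphere_degree :: "nat \<Rightarrow> ('a::euclidean_space \<Rightarrow> 'a) \<Rightarrow> int" where
  "flat_sphere_degree m G = Brouwer_degree2 m (coords \<circ> G \<circ> of_coords)"

lemma continuous_map_conjugate:
  assumes "m < DIM('a)" "continuous_on (flat_sphere (Suc m) :: 'a::euclidean_space set) G"
    "G \<in> flat_sphere (Suc m) \<rightarrow> (flat_sphere (Suc m) :: 'a::euclidean_space set)"
  shows "continuous_map (nsphere m) (nsphere m) (coords \<circ> G \<circ> of_coords)"
proof -
  have "continuous_map (top_of_set (flat_sphere (Suc m) :: 'a set)) (top_of_set (flat_sphere (Suc m))) G"
    using assms by (simp add: image_subset_iff_funcset)
  then show ?thesis
    by (intro continuous_map_compose[OF continuous_map_of_coords[OF assms(1)]]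
        continuous_map_compose[OF _ continuous_map_coords[OF assms(1)]])
qed

text \<open>The segment from \<open>G x\<close> to \<open>H x\<close> avoids the origin unless the two points are antipodal, so the
straight-line homotopy can be normalised to one inside the sphere.\<close>

lemma degree_eq_if_nowhere_antipodal:
  fixes G H :: "'a::euclidean_space \<Rightarrow> 'a"
  assumes m: "m < DIM('a)"
    and G: "continuous_on (flat_sphere (Suc m)) G" "G \<in> flat_sphere (Suc m) \<rightarrow> flat_sphere (Suc m)"
    and H: "continuous_on (flat_sphere (Suc m)) H" "H \<in> flat_sphere (Suc m) \<rightarrow> flat_sphere (Suc m)"
    and ne: "\<And>x. x \<in> flat_sphere (Suc m) \<Longrightarrow> G x \<noteq> - H x"
  shows "flat_sphere_degree m G = flat_sphere_degree m H"
proof -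
  let ?S = "flat_sphere (Suc m) :: 'a set" and ?T = "flat (Suc m) :: 'a set"
  let ?n = "\<lambda>y::'a. inverse (norm y) *\<^sub>R y"
  have nG: "norm (G x) = 1" "norm (H x) = 1" "G x \<in> ?T" "H x \<in> ?T" if "x \<in> ?S" for x
    using G(2) H(2) that by (auto simp: flat_sphere_def)
  have seg0: "0 \<notin> closed_segment (G x) (H x)" if x: "x \<in> ?S" for x
  proof
    assume "0 \<in> closed_segment (G x) (H x)"
    then obtain u where u: "0 \<le> u" "u \<le> 1" "0 = (1 - u) *\<^sub>R G x + u *\<^sub>R H x"
      by (auto simp: closed_segment_def)
    then have e: "(1 - u) *\<^sub>R G x = - (u *\<^sub>R H x)" by (metis add.inverse_unique minus_equation_iff)
    then have "\<bar>1 - u\<bar> = \<bar>u\<bar>" using nG[OF x] by (metis mult.right_neutral norm_minus_cancel norm_scaleR)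
    then have u2: "u = 1/2" using u by auto
    have "(1/2) *\<^sub>R G x = (1/2) *\<^sub>R (- H x)" using e unfolding u2 by simp
    then have "G x = - H x" unfolding real_vector.scale_cancel_left by simp
    then show False using ne[OF x] by simp
  qed
  have hom: "homotopic_with_canon (\<lambda>z. True) ?S (?T - {0}) G H"
  proof (rule homotopic_with_linear[OF G(1) H(1)])
    fix x assume x: "x \<in> ?S"
    have "closed_segment (G x) (H x) \<subseteq> ?T"
      using nG[OF x] by (simp add: closed_segment_subset subspace_imp_convex)
    then show "closed_segment (G x) (H x) \<subseteq> ?T - {0}"
      using seg0[OF x] by auto
  qed
  have "continuous_on (?T - {0}) ?n"
    by (intro continuous_intros) auto
  moreover have "?n \<in> (?T - {0}) \<rightarrow> ?S"
    using normalize_in_flat_sphere by auto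
  ultimately have "homotopic_with_canon (\<lambda>z. True) ?S ?S (?n \<circ> G) (?n \<circ> H)"
    by (rule homotopic_with_compose_continuous_left[OF hom])
  then have "homotopic_with (\<lambda>z. True) (nsphere m) (nsphere m)
      (coords \<circ> ((?n \<circ> G) \<circ> of_coords)) (coords \<circ> ((?n \<circ> H) \<circ> of_coords))"
    by (intro homotopic_with_compose_continuous_map_left[OF _ continuous_map_coords[OF m]]
        homotopic_with_compose_continuous_map_right[OF _ continuous_map_of_coords[OF m]])
      auto
  then have "Brouwer_degree2 m (coords \<circ> ((?n \<circ> G) \<circ> of_coords))
      = Brouwer_degree2 m (coords \<circ> ((?n \<circ> H) \<circ> of_coords))"
    by (rule Brouwer_degree2_homotopic)
  moreover have "Brouwer_degree2 m (coords \<circ> ((?n \<circ> K) \<circ> of_coords)) = flat_sphere_degree m K"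
    if "K = G \<or> K = H" for K
    unfolding flat_sphere_degree_def
    by (rule Brouwer_degree2_eq) (use that nG of_coords_in_flat_sphere[OF m] in auto)
  ultimately show ?thesis by simp
qed

lemma degree_compose:
  fixes G H :: "'a::euclidean_space \<Rightarrow> 'a"
  assumes m: "m < DIM('a)"
    and G: "continuous_on (flat_sphere (Suc m)) G" "G \<in> flat_sphere (Suc m) \<rightarrow> flat_sphere (Suc m)"
    and H: "continuous_on (flat_sphere (Suc m)) H" "H \<in> flat_sphere (Suc m) \<rightarrow> flat_sphere (Suc m)"
  shows "flat_sphere_degree m (H \<circ> G) = flat_sphere_degree m H * flat_sphere_degree m G"
proof -
  have "flat_sphere_degree m (H \<circ> G)
      = Brouwer_degree2 m ((coords \<circ> H \<circ> of_coords) \<circ> (coords \<circ> G \<circ> of_coords :: (nat \<Rightarrow> real) \<Rightarrow> _))"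
    unfolding flat_sphere_degree_def
    by (rule Brouwer_degree2_eq) simp
  also have "\<dots> = flat_sphere_degree m H * flat_sphere_degree m G"
    unfolding flat_sphere_degree_def
    by (intro Brouwer_degree2_compose continuous_map_conjugate assms)
  finally show ?thesis .
qed

text \<open>The sphere of dimension zero is a pair of antipodal points, whose only odd self-maps are the
identity and the reflection.\<close>

lemma odd_degree_dim0:
  fixes G :: "'a::euclidean_space \<Rightarrow> 'a"
  assumes G: "G \<in> flat_sphere (Suc 0) \<rightarrow> flat_sphere (Suc 0)"
    and o: "\<And>x. x \<in> flat_sphere (Suc 0) \<Longrightarrow> G (- x) = - G x"
  shows "odd (flat_sphere_degree 0 G)"
proof -
  have D: "0 < DIM('a)" by simp
  let ?e = "basis_vec 0 :: 'a"
  have S: "x = ?e \<or> x = - ?e" if "x \<in> flat_sphere (Suc 0)" for x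
  proof -
    have c: "coords x \<in> topspace (nsphere 0)" by (rule coords_in_nsphere[OF D that])
    then have "(coords x 0)\<^sup>2 = 1" by (auto simp: nsphere)
    then have "coords x 0 = 1 \<or> coords x 0 = -1" by (simp add: power2_eq_1_iff)
    moreover have "coords x i = 0" if "i \<noteq> 0" for i
      using c that by (auto simp: nsphere)
    ultimately have "coords x = coords ?e \<or> coords x = coords (- ?e)"
      by (auto simp: fun_eq_iff coords_basis_vec)
    then show ?thesis by (metis of_coords_coords)
  qed
  have e: "?e \<in> flat_sphere (Suc 0)" by (rule basis_vec_in_flat_sphere) auto
  have "flat_sphere_degree 0 G = 1" if "G ?e = ?e"
  proof -
    have "G x = x" if "x \<in> flat_sphere (Suc 0)" for x
      using S[OF that] \<open>G ?e = ?e\<close> o[OF e] by auto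
    then have "flat_sphere_degree 0 G = Brouwer_degree2 0 id"
      unfolding flat_sphere_degree_def
      by (intro Brouwer_degree2_eq)
        (simp add: of_coords_in_flat_sphere[OF D] coords_of_coords_nsphere[OF D])
    then show ?thesis by simp
  qed
  moreover have "flat_sphere_degree 0 G = - 1" if "G ?e = - ?e"
  proof -
    have Gx: "G x = - x" if "x \<in> flat_sphere (Suc 0)" for x
      using S[OF that] \<open>G ?e = - ?e\<close> o[OF e] by auto
    have "flat_sphere_degree 0 G = Brouwer_degree2 0 (\<lambda>x i. if i = 0 then - x i else x i)"
      unfolding flat_sphere_degree_def
    proof (rule Brouwer_degree2_eq)
      fix y :: "nat \<Rightarrow> real" assume y: "y \<in> topspace (nsphere 0)"
      have "(coords \<circ> G \<circ> of_coords) y = (\<lambda>i. - y i)"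
        using Gx[OF of_coords_in_flat_sphere[OF D y]] coords_of_coords_nsphere[OF D y]
        by (auto simp: fun_eq_iff)
      then show "(coords \<circ> G \<circ> of_coords) y = (\<lambda>i. if i = 0 then - y i else y i)"
        using y by (auto simp: nsphere fun_eq_iff)
    qed
    then show ?thesis by (simp add: Brouwer_degree2_reflection)
  qed
  ultimately show ?thesis
    using S[OF funcset_mem[OF G e]] by auto
qed

text \<open>The congruence of the degrees of an odd map on a sphere and on its equator presupposes that the
equator is mapped into itself; a general odd map has to be deformed before it applies.\<close>

lemma odd_degree_step:
  fixes G :: "'a::euclidean_space \<Rightarrow> 'a"
  assumes m: "Suc m < DIM('a)"
    and G: "continuous_on (flat_sphere (Suc (Suc m))) G"
      "G \<in> flat_sphere (Suc (Suc m)) \<rightarrow> flat_sphere (Suc (Suc m))"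
    and eq: "G \<in> flat_sphere (Suc m) \<rightarrow> flat_sphere (Suc m)"
    and o: "\<And>x. x \<in> flat_sphere (Suc (Suc m)) \<Longrightarrow> G (- x) = - G x"
  shows "even (flat_sphere_degree (Suc m) G - flat_sphere_degree m G)"
proof -
  let ?f = "coords \<circ> G \<circ> of_coords"
  have "even (Brouwer_degree2 (Suc m) ?f - Brouwer_degree2 (Suc m - Suc 0) ?f)"
  proof (rule Borsuk_odd_mapping_degree_step)
    show "continuous_map (nsphere (Suc m)) (nsphere (Suc m)) ?f"
      by (rule continuous_map_conjugate[OF m G])
    fix u :: "nat \<Rightarrow> real" assume "u \<in> topspace (nsphere (Suc m))"
    then show "(?f \<circ> (\<lambda>x i. - x i)) u = ((\<lambda>x i. - x i) \<circ> ?f) u"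
      using o[OF of_coords_in_flat_sphere[OF m]] by (auto simp: of_coords_minus fun_eq_iff)
  next
    show "?f \<in> topspace (nsphere (Suc m - Suc 0)) \<rightarrow> topspace (nsphere (Suc m - Suc 0))"
      using eq m by (auto intro!: coords_in_nsphere funcset_mem[OF eq] of_coords_in_flat_sphere)
  qed
  then show ?thesis by (simp add: flat_sphere_degree_def)
qed

section \<open>Odd maps have odd degree\<close>

lemma flat_sphere_equator:
  assumes "x \<in> flat_sphere (Suc k)" "coords x k = 0"
  shows "x \<in> flat_sphere k"
proof -
  have "coords x i = 0" if "k \<le> i" for i
    using assms that by (cases "i = k") (auto simp: flat_sphere_def flat_def)
  then show ?thesis using assms by (simp add: flat_sphere_def flat_def)
qed

text \<open>The reflection in the hyperplane orthogonal to \<open>v\<close>. For \<open>v = 0\<close> division by zero makes it the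
identity, so that two vectors of equal norm are exchanged by it without a case distinction.\<close>

definition hyperplane_reflection :: "'a::real_inner \<Rightarrow> 'a \<Rightarrow> 'a" where
  "hyperplane_reflection v x = x - (2 * (x \<bullet> v) / (v \<bullet> v)) *\<^sub>R v"

lemma inner_hyperplane_reflection:
  "hyperplane_reflection v x \<bullet> hyperplane_reflection v y = x \<bullet> y"
proof (cases "v = 0")
  case False
  define c where "c = v \<bullet> v"
  have "c \<noteq> 0" using False by (simp add: c_def)
  have "hyperplane_reflection v x \<bullet> hyperplane_reflection v y
      = x \<bullet> y - 4 * (x \<bullet> v) * (y \<bullet> v) / c + (4 * (x \<bullet> v) * (y \<bullet> v) / (c * c)) * c"
    by (simp add: hyperplane_reflection_def inner_diff_left inner_diff_right inner_commute flip: c_def)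
  also have "\<dots> = x \<bullet> y" using \<open>c \<noteq> 0\<close> by simp
  finally show ?thesis .
qed (simp add: hyperplane_reflection_def)

lemma norm_hyperplane_reflection: "norm (hyperplane_reflection v x) = norm x"
  by (simp add: norm_eq_sqrt_inner inner_hyperplane_reflection)

lemma hyperplane_reflection_swaps:
  assumes "norm p = norm e"
  shows "hyperplane_reflection (p - e) p = e"
proof (cases "p = e")
  case False
  have pe: "p \<bullet> p = e \<bullet> e" using assms by (metis power2_norm_eq_inner)
  have "(p - e) \<bullet> (p - e) = 2 * (p \<bullet> (p - e))"
    using pe by (simp add: inner_diff_left inner_diff_right inner_commute)
  moreover have "(p - e) \<bullet> (p - e) \<noteq> 0" unfolding inner_eq_zero_iff using False by simp
  ultimately have "2 * (p \<bullet> (p - e)) / ((p - e) \<bullet> (p - e)) = 1"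
    by (metis right_inverse_eq)
  then show ?thesis unfolding hyperplane_reflection_def by (simp only:) simp
qed (simp add: hyperplane_reflection_def)

text \<open>Induction on the dimension. To make \<open>G\<close> preserve the equator, it is deformed through maps that
are nowhere antipodal to each other, hence of the same degree. A normalised odd polynomial map \<open>q\<close> close to
\<open>G\<close> sends the equator to a null set of the sphere, so it misses a point \<open>p\<close> there, and \<open>- p\<close> by
oddness. Subtracting from \<open>q\<close> its component along \<open>p\<close>, completely on the equator and only partly
elsewhere, gives a map \<open>h\<close> that sends the equator into the hyperplane orthogonal to \<open>p\<close>. A
reflection \<open>R\<close> taking \<open>p\<close> to the pole moves this hyperplane to that of the equator. The degree of
\<open>R \<circ> h\<close> is then congruent modulo 2 to the degree on the equator, odd by induction, and it is the
product of the degrees of \<open>R\<close> and \<open>h\<close>.\<close>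

theorem odd_degree_of_odd_map:
  fixes G :: "'a::euclidean_space \<Rightarrow> 'a"
  assumes "m < DIM('a)"
    and "continuous_on (flat_sphere (Suc m)) G" "G \<in> flat_sphere (Suc m) \<rightarrow> flat_sphere (Suc m)"
    and "\<And>x. x \<in> flat_sphere (Suc m) \<Longrightarrow> G (- x) = - G x"
  shows "odd (flat_sphere_degree m G)"
  using assms
proof (induction m arbitrary: G)
  case 0
  then show ?case by (intro odd_degree_dim0) auto
next
  case (Suc m G)
  let ?S = "flat_sphere (Suc (Suc m)) :: 'a set" and ?S' = "flat_sphere (Suc m) :: 'a set"
  let ?T = "flat (Suc (Suc m)) :: 'a set"
  note m = \<open>Suc m < DIM('a)\<close>
  have SS: "?S' \<subseteq> ?S" by (rule flat_sphere_mono) simp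
  have normS: "norm x = 1" "x \<in> ?T" if "x \<in> ?S" for x using that by (auto simp: flat_sphere_def)
  have GS: "G x \<in> ?S" if "x \<in> ?S" for x using Suc.prems(3) that by auto
  have GT: "G ` ?S \<subseteq> ?T" using GS normS by blast
  obtain P where P: "polynomial_function P" "P ` ?S \<subseteq> ?T"
      and PG: "\<And>x. x \<in> ?S \<Longrightarrow> norm (G x - P x) < 1/2"
    by (rule Stone_Weierstrass_polynomial_function_subspace[OF compact_flat_sphere Suc.prems(2) _
          subspace_flat GT, of "1/2"]) simp_all
  \<comment> \<open>Taking the odd part keeps the approximation, because \<open>G\<close> is odd itself.\<close>
  define Q where "Q x = (1/2) *\<^sub>R (P x - P (- x))" for x
  have Q_minus: "Q (- x) = - Q x" for x
    unfolding Q_def by (simp flip: scaleR_minus_right)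
  have "polynomial_function Q"
  proof -
    have "polynomial_function (P \<circ> uminus)"
      by (intro polynomial_function_compose P polynomial_function_minus polynomial_function_id)
    then show ?thesis
      unfolding Q_def o_def
      by (intro polynomial_function_cmul polynomial_function_diff P)
  qed
  then have Q_diff: "Q differentiable_on X" for X
    by (rule differentiable_on_polynomial_function)
  have QT: "Q x \<in> ?T" if "x \<in> ?S" for x
    using P(2) that flat_sphere_minus[of x] unfolding Q_def
    by (intro subspace_scale subspace_diff subspace_flat) auto
  have QG: "norm (G x - Q x) < 1" if x: "x \<in> ?S" for x
  proof -
    have "G x - Q x = (1/2) *\<^sub>R ((G x - P x) - (G (- x) - P (- x)))"
      unfolding Suc.prems(4)[OF x] Q_def using scaleR_half_double[of "G x"]
      by (simp add: scaleR_diff_right scaleR_add_right)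
    also have "norm \<dots> \<le> (1/2) * (norm (G x - P x) + norm (G (- x) - P (- x)))"
      using norm_triangle_ineq4 by (simp add: norm_scaleR)
    also have "\<dots> < 1"
      using PG[OF x] PG[of "- x"] x flat_sphere_minus[of x] by simp
    finally show ?thesis .
  qed
  have Q0: "Q x \<noteq> 0" if "x \<in> ?S" for x
    using QG[OF that] normS(1)[OF GS[OF that]] by auto
  define q where "q x = inverse (norm (Q x)) *\<^sub>R Q x" for x
  have qS: "q x \<in> ?S" if "x \<in> ?S" for x
    unfolding q_def using normalize_in_flat_sphere[OF QT Q0] that by blast
  have q_minus: "q (- x) = - q x" for x by (simp add: q_def Q_minus)
  have q_diff: "q differentiable_on ?S"
    unfolding q_def using Q0
    by (fastforce intro: derivative_intros Q_diff differentiable_on_compose[OF Q_diff])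
  then have q_cont: "continuous_on ?S q" by (rule differentiable_imp_continuous_on)
  have deg_Gq: "flat_sphere_degree (Suc m) G = flat_sphere_degree (Suc m) q"
  proof (rule degree_eq_if_nowhere_antipodal[OF m Suc.prems(2,3) q_cont])
    fix x assume x: "x \<in> ?S"
    show "G x \<noteq> - q x"
    proof
      assume e: "G x = - q x"
      have "Q x = norm (Q x) *\<^sub>R q x" using Q0[OF x] by (simp add: q_def)
      then have "G x - Q x = (1 + norm (Q x)) *\<^sub>R G x" using e by (simp add: algebra_simps)
      then have "norm (G x - Q x) = \<bar>1 + norm (Q x)\<bar>"
        using normS(1)[OF GS[OF x]] by simp
      then show False using QG[OF x] by (smt (verit) norm_ge_zero)
    qed
  qed (use qS in auto)
  \<comment> \<open>A differentiable map cannot fill a sphere of larger dimension.\<close>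
  have "dim (flat (Suc m) :: 'a set) < dim ?T"
  proof (rule dim_psubset)
    have "basis_vec (Suc m) \<in> ?T" using basis_vec_in_flat_sphere[of "Suc m" "Suc (Suc m)"] m
      by (auto simp: flat_sphere_def)
    then have "(flat (Suc m) :: 'a set) \<subset> ?T"
      using basis_vec_notin_flat[OF m] flat_mono[of "Suc m" "Suc (Suc m)"] by auto
    then show "span (flat (Suc m) :: 'a set) \<subset> span ?T"
      by (simp add: span_eq_iff[THEN iffD2])
  qed
  then have "q ` ?S' \<noteq> ?S"
    unfolding flat_sphere_def
    by (intro spheremap_lemma1 flat_mono subspace_flat)
      (use q_diff SS in \<open>auto simp: flat_sphere_def intro: differentiable_on_subset\<close>)
  moreover have "q ` ?S' \<subseteq> ?S" using qS SS by auto
  ultimately obtain p where p: "p \<in> ?S" "p \<notin> q ` ?S'" by auto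
  have qp: "q x \<noteq> p" "q x \<noteq> - p" if "x \<in> ?S'" for x
  proof -
    show "q x \<noteq> p" using p that by auto
    show "q x \<noteq> - p"
      using p that flat_sphere_minus[of x] by (metis q_minus image_eqI minus_minus)
  qed
  have np: "norm p = 1" "p \<bullet> p = 1" "p \<in> ?T" using normS[OF p(1)] by (auto simp: norm_eq_1)
  \<comment> \<open>An even weight that equals 1 exactly on the equator: this keeps \<open>r\<close> below odd and without zeros,
      as \<open>q x\<close> can be a multiple of \<open>p\<close> only where the weight is less than 1.\<close>
  define \<phi> where "\<phi> x = 1 - (coords x (Suc m))\<^sup>2" for x :: 'a
  define r where "r x = q x - (\<phi> x * (q x \<bullet> p)) *\<^sub>R p" for x
  have \<phi>: "0 \<le> \<phi> x" "\<phi> x \<le> 1" if "x \<in> ?S" for x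
  proof -
    have "\<bar>coords x (Suc m)\<bar> \<le> 1"
      using normS(1)[OF that] m Basis_le_norm[of "basis_vec (Suc m)" x] by (simp add: coords_def)
    then show "0 \<le> \<phi> x" "\<phi> x \<le> 1" by (auto simp: \<phi>_def abs_square_le_1)
  qed
  have qps: "(q x \<bullet> p)\<^sup>2 \<le> 1" if "x \<in> ?S" for x
    using Cauchy_Schwarz_ineq2[of "q x" p] normS(1)[OF qS[OF that]] np by (simp add: abs_square_le_1)
  have r0: "r x \<noteq> 0" if x: "x \<in> ?S" for x
  proof
    assume "r x = 0"
    then have e: "q x = (\<phi> x * (q x \<bullet> p)) *\<^sub>R p" by (simp add: r_def)
    then have s: "q x \<bullet> p = \<phi> x * (q x \<bullet> p)" using np by (metis inner_scaleR_left mult.right_neutral)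
    have e': "q x = (q x \<bullet> p) *\<^sub>R p" using e s by simp
    then have "\<bar>q x \<bullet> p\<bar> = 1"
      using normS(1)[OF qS[OF x]] np by (metis mult.right_neutral norm_scaleR)
    then have "\<phi> x = 1" "q x \<bullet> p = 1 \<or> q x \<bullet> p = -1" using s by auto
    then have "coords x (Suc m) = 0" "q x = p \<or> q x = - p"
      using e' by (auto simp: \<phi>_def)
    moreover have "x \<in> ?S'"
      by (rule flat_sphere_equator[OF x \<open>coords x (Suc m) = 0\<close>])
    ultimately show False using qp by auto
  qed
  have r_cont: "continuous_on ?S r"
    unfolding r_def \<phi>_def coords_def using m
    by (auto intro!: continuous_intros q_cont)
  have rT: "r x \<in> ?T" if "x \<in> ?S" for x
    unfolding r_def using normS(2)[OF qS[OF that]] np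
    by (intro subspace_diff subspace_scale subspace_flat) auto
  have r_minus: "r (- x) = - r x" for x by (simp add: r_def \<phi>_def q_minus)
  \<comment> \<open>The inner product of \<open>r x\<close> and \<open>q x\<close> turns out nonnegative, so \<open>h\<close> is nowhere antipodal to \<open>q\<close>.\<close>
  define h where "h x = inverse (norm (r x)) *\<^sub>R r x" for x
  have hS: "h x \<in> ?S" if "x \<in> ?S" for x
    unfolding h_def using normalize_in_flat_sphere[OF rT r0] that by blast
  have h_cont: "continuous_on ?S h"
    unfolding h_def using r0 by (auto intro!: continuous_intros r_cont)
  have deg_qh: "flat_sphere_degree (Suc m) q = flat_sphere_degree (Suc m) h"
  proof (rule degree_eq_if_nowhere_antipodal[OF m q_cont _ h_cont])
    fix x assume x: "x \<in> ?S"
    show "q x \<noteq> - h x"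
    proof
      assume e: "q x = - h x"
      have "r x = norm (r x) *\<^sub>R h x" using r0[OF x] by (simp add: h_def)
      then have "r x = (- norm (r x)) *\<^sub>R q x" using e by simp
      then have "r x \<bullet> q x = (- norm (r x)) * (q x \<bullet> q x)" by (metis inner_scaleR_left)
      also have "\<dots> < 0" using r0[OF x] normS(1)[OF qS[OF x]] by (simp add: norm_eq_1)
      finally have "r x \<bullet> q x < 0" .
      moreover have "r x \<bullet> q x = 1 - \<phi> x * (q x \<bullet> p)\<^sup>2"
        using normS(1)[OF qS[OF x]]
        by (simp add: r_def inner_simps norm_eq_1 power2_eq_square inner_commute)
      moreover have "\<phi> x * (q x \<bullet> p)\<^sup>2 \<le> 1 * 1"
        using \<phi>[OF x] qps[OF x] by (intro mult_mono) auto
      ultimately show False by simp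
    qed
  qed (use qS hS in auto)
  let ?e = "basis_vec (Suc m) :: 'a"
  have e: "?e \<in> ?S" using m by (intro basis_vec_in_flat_sphere) auto
  define R where "R = hyperplane_reflection (p - ?e)"
  have Rp: "R p = ?e"
    unfolding R_def using normS[OF e] np by (intro hyperplane_reflection_swaps) auto
  have RS: "R x \<in> ?S" if "x \<in> ?S" for x
  proof -
    have "R x \<in> ?T"
      unfolding R_def hyperplane_reflection_def
      using normS[OF that] normS[OF e] np
      by (intro subspace_diff subspace_scale subspace_flat) auto
    then show ?thesis
      using normS[OF that] by (simp add: flat_sphere_def R_def norm_hyperplane_reflection)
  qed
  have R_cont: "continuous_on X R" for X
    unfolding R_def hyperplane_reflection_def
    by (cases "p = ?e") (auto intro!: continuous_intros)
  have R_minus: "R (- x) = - R x" for x by (simp add: R_def hyperplane_reflection_def)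
  have equator: "(R \<circ> h) x \<in> ?S'" if x: "x \<in> ?S'" for x
  proof -
    have "\<phi> x = 1" using x by (auto simp: \<phi>_def flat_sphere_def flat_def)
    then have "h x \<bullet> p = 0" by (simp add: h_def r_def inner_simps np)
    then have "R (h x) \<bullet> ?e = 0"
      using inner_hyperplane_reflection[of "p - ?e" "h x" p] Rp by (simp add: R_def)
    then have "coords (R (h x)) (Suc m) = 0" by (simp add: coords_def)
    moreover have "R (h x) \<in> ?S" using x SS hS RS by auto
    ultimately show ?thesis
      unfolding o_def by (rule flat_sphere_equator[rotated])
  qed
  have Rh_cont: "continuous_on ?S (R \<circ> h)" by (intro continuous_on_compose h_cont R_cont)
  have h_minus: "h (- x) = - h x" for x by (simp add: h_def r_minus)
  have "odd (flat_sphere_degree m (R \<circ> h))"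
  proof (rule Suc.IH)
    show "continuous_on ?S' (R \<circ> h)" using Rh_cont SS by (rule continuous_on_subset)
  qed (use m equator in \<open>auto simp: h_minus R_minus\<close>)
  moreover have "even (flat_sphere_degree (Suc m) (R \<circ> h) - flat_sphere_degree m (R \<circ> h))"
    by (rule odd_degree_step[OF m Rh_cont]) (use equator hS RS in \<open>auto simp: h_minus R_minus\<close>)
  ultimately have "odd (flat_sphere_degree (Suc m) (R \<circ> h))" by auto
  moreover have "flat_sphere_degree (Suc m) (R \<circ> h) = flat_sphere_degree (Suc m) R * flat_sphere_degree (Suc m) h"
    by (rule degree_compose[OF m h_cont _ R_cont]) (use hS RS in auto)
  ultimately show ?case using deg_Gq deg_qh by auto
qed

text \<open>An odd map to a lower-dimensional sphere, read as a self-map of its domain, misses a point. Its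
degree is therefore 0, which is not odd.\<close>

theorem Borsuk_Ulam_flat_sphere:
  fixes G :: "'a::euclidean_space \<Rightarrow> 'a"
  assumes k: "k \<le> DIM('a)" "j < k"
    and cont: "continuous_on (flat_sphere k) G" and into: "G \<in> flat_sphere k \<rightarrow> flat_sphere j"
    and odd: "\<And>x. x \<in> flat_sphere k \<Longrightarrow> G (- x) = - G x"
  shows False
proof -
  obtain m where m: "k = Suc m" using k by (cases k) auto
  have mD: "m < DIM('a)" using k m by simp
  have self: "G \<in> flat_sphere (Suc m) \<rightarrow> flat_sphere (Suc m)"
    using into flat_sphere_mono[of j k] k unfolding m by auto
  have "flat_sphere_degree m G = 0"
    unfolding flat_sphere_degree_def
  proof (rule Brouwer_degree2_nonsurjective)
    show "continuous_map (nsphere m) (nsphere m) (coords \<circ> G \<circ> of_coords)"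
      using cont self unfolding m by (intro continuous_map_conjugate mD)
    let ?e = "basis_vec m :: 'a"
    have e: "coords ?e \<in> topspace (nsphere m)"
      using mD by (intro coords_in_nsphere basis_vec_in_flat_sphere) auto
    moreover have "coords ?e \<notin> (coords \<circ> G \<circ> of_coords) ` topspace (nsphere m)"
    proof
      assume "coords ?e \<in> (coords \<circ> G \<circ> of_coords) ` topspace (nsphere m)"
      then obtain y where y: "y \<in> topspace (nsphere m)" "coords ?e = coords (G (of_coords y))" by auto
      then have "?e = G (of_coords y)" by (metis of_coords_coords)
      moreover have "G (of_coords y) \<in> flat_sphere j"
        using into of_coords_in_flat_sphere[OF mD y(1)] unfolding m by auto
      ultimately have "?e \<in> flat m"
        using flat_mono[of j m] k unfolding m by (auto simp: flat_sphere_def)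
      then show False using basis_vec_notin_flat[OF mD] by simp
    qed
    ultimately show "(coords \<circ> G \<circ> of_coords) ` topspace (nsphere m) \<noteq> topspace (nsphere m)" by auto
  qed
  moreover have "odd (flat_sphere_degree m G)"
    using cont self odd unfolding m by (intro odd_degree_of_odd_map mD)
  ultimately show False by simp
qed

section \<open>Bounds for the genus\<close>

text \<open>The vector of the inner products with \<open>c 0, \<dots>, c (k - 1)\<close> depends linearly on \<open>x\<close>, so where it
does not vanish its normalisation is an odd map. This is the only source of upper bounds for
the genus that is needed.\<close>

lemma odd_map_to_sphere_of_inner_products:
  fixes c :: "nat \<Rightarrow> 'a::real_inner"
  assumes "1 \<le> k" and ne: "\<And>x. x \<in> T \<Longrightarrow> \<exists>i<k. x \<bullet> c i \<noteq> 0"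
  shows "odd_map_to_sphere T k"
proof -
  define r where "r x = sqrt (\<Sum>j<k. (x \<bullet> c j)\<^sup>2)" for x
  define f where "f x = (\<lambda>i. if i < k then (x \<bullet> c i) / r x else 0)" for x
  have pos: "0 < (\<Sum>j<k. (x \<bullet> c j)\<^sup>2)" if x: "x \<in> T" for x
  proof -
    obtain i where "i < k" "x \<bullet> c i \<noteq> 0" using ne[OF x] by auto
    then show ?thesis by (intro sum_pos2[of _ i]) auto
  qed
  have r: "0 < r x" "(r x)\<^sup>2 = (\<Sum>j<k. (x \<bullet> c j)\<^sup>2)" if "x \<in> T" for x
    using pos[OF that] by (auto simp: r_def)
  have cont: "continuous_on T (\<lambda>x. f x i)" for i
    unfolding f_def
  proof (cases "i < k")
    case True
    have "continuous_on T r" unfolding r_def by (intro continuous_intros)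
    then have "continuous_on T (\<lambda>x. x \<bullet> c i / r x)"
      by (intro continuous_intros) (use r in force)+
    then show "continuous_on T (\<lambda>x. if i < k then x \<bullet> c i / r x else 0)" using True by simp
  qed simp
  have sph: "(\<Sum>i\<le>k - 1. (f x i)\<^sup>2) = 1" if "x \<in> T" for x
  proof -
    have "{..k - 1} = {..<k}" using assms(1) by auto
    then have "(\<Sum>i\<le>k - 1. (f x i)\<^sup>2) = (\<Sum>i<k. (x \<bullet> c i)\<^sup>2) / (r x)\<^sup>2"
      by (simp add: f_def power_divide sum_divide_distrib)
    then show ?thesis using r[OF that] pos[OF that] by simp
  qed
  have zero: "f x i = 0" if "k \<le> i" for x i using that by (simp add: f_def)
  have "continuous_map (top_of_set T) (nsphere (k - 1)) f"
    unfolding nsphere continuous_map_in_subtopology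
    using cont sph zero assms(1) by (auto simp: continuous_map_componentwise_UNIV)
  moreover have "f (- x) = (\<lambda>i. - f x i)" for x
    by (auto simp: f_def r_def)
  ultimately show ?thesis unfolding odd_map_to_sphere_def by blast
qed

lemma genus_le:
  fixes c :: "nat \<Rightarrow> 'a::real_inner"
  assumes "1 \<le> k" and "\<And>x. x \<in> T \<Longrightarrow> \<exists>i<k. x \<bullet> c i \<noteq> 0"
  shows "genus T \<le> k"
  unfolding genus_def
  using odd_map_to_sphere_of_inner_products[OF assms] assms(1) by (intro Least_le) auto

text \<open>The genus is the least element of a set that has to be known to be nonempty before the least
element says anything: the coordinate map provides a member.\<close>

lemma genus_attained:
  fixes T :: "'a::euclidean_space set"
  assumes "0 \<notin> T"
  shows "1 \<le> genus T \<and> odd_map_to_sphere T (genus T)"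
proof -
  have "\<exists>i<DIM('a). x \<bullet> basis_vec i \<noteq> 0" if "x \<in> T" for x
  proof (rule ccontr)
    assume "\<not> ?thesis"
    then have "coords x = coords 0" by (auto simp: coords_def fun_eq_iff)
    then have "x = 0" by (metis of_coords_coords)
    then show False using that assms by simp
  qed
  then have "odd_map_to_sphere T DIM('a)"
    by (intro odd_map_to_sphere_of_inner_products[where c = basis_vec]) auto
  then have "1 \<le> DIM('a) \<and> odd_map_to_sphere T DIM('a)" by (simp add: Suc_leI)
  then show ?thesis unfolding genus_def by (rule LeastI)
qed

lemma dim_flat:
  assumes "k \<le> DIM('a)"
  shows "dim (flat k :: 'a::euclidean_space set) = k"
proof -
  let ?B = "basis_vec ` {..<k} :: 'a set"
  have sub: "?B \<subseteq> Basis" using assms by auto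
  have inj: "inj_on (basis_vec :: nat \<Rightarrow> 'a) {..<k}"
    by (rule inj_on_subset[OF bij_betw_imp_inj_on[OF bij_basis_vec]]) (use assms in auto)
  have "x \<in> span ?B" if "x \<in> flat k" for x
  proof -
    have "coords x i *\<^sub>R basis_vec i \<in> span ?B" for i
      using that by (cases "i < k") (auto simp: flat_def intro: span_scale span_base span_zero)
    then have "(of_coords (coords x) :: 'a) \<in> span ?B"
      unfolding of_coords_def by (intro span_sum)
    then show ?thesis by simp
  qed
  moreover have "?B \<subseteq> flat k"
    using assms basis_vec_in_flat_sphere[of _ k, where 'a = 'a] by (auto simp: flat_sphere_def)
  then have "span ?B \<subseteq> flat k" by (simp add: span_minimal)
  ultimately have "span ?B = span (flat k)"
    by (metis subspace_flat span_eq_iff subsetI subset_antisym)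
  then have "dim (flat k :: 'a set) = card ?B"
    using independent_mono[OF independent_Basis sub] by (intro dim_eq_card)
  then show ?thesis using inj by (simp add: card_image)
qed

text \<open>Division by \<open>N x\<close> maps the Euclidean unit sphere of \<open>V\<close> into \<open>T\<close>, oddly and continuously. Composing with a map that realises the genus of \<open>T\<close> gives an odd map
between Euclidean spheres, to which the Borsuk-Ulam theorem applies.\<close>

lemma dim_le_genus:
  fixes T V :: "'a::euclidean_space set" and N :: "'a \<Rightarrow> real"
  assumes T: "0 \<notin> T" and V: "subspace V"
    and N: "continuous_on UNIV N" "\<And>x. N (- x) = N x"
    and pos: "\<And>x. x \<in> V \<Longrightarrow> x \<noteq> 0 \<Longrightarrow> N x \<noteq> 0"
    and into: "\<And>x. x \<in> V \<Longrightarrow> x \<noteq> 0 \<Longrightarrow> x /\<^sub>R N x \<in> T"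
  shows "dim V \<le> genus T"
proof (rule ccontr)
  assume "\<not> dim V \<le> genus T"
  then have less: "genus T < dim V" by simp
  define k where "k = dim V"
  have k: "k \<le> DIM('a)" by (simp add: k_def dim_subset_UNIV)
  obtain m where m: "genus T = Suc m" using genus_attained[OF T] by (cases "genus T") auto
  have mD: "m < DIM('a)" using less k m by (simp add: k_def)
  obtain f where f: "continuous_map (top_of_set T) (nsphere m) f"
      and f_odd: "\<And>x. x \<in> T \<Longrightarrow> f (- x) = (\<lambda>i. - f x i)"
    using genus_attained[OF T] unfolding odd_map_to_sphere_def m by auto
  obtain L :: "'a \<Rightarrow> 'a" where L: "linear L" "L ` flat k = V" "\<And>x. x \<in> flat k \<Longrightarrow> norm (L x) = norm x"
    using isometries_subspaces[OF subspace_flat V, of k] dim_flat[OF k] unfolding k_def by metis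
  have LV: "L x \<in> V" "L x \<noteq> 0" if "x \<in> flat_sphere k" for x
    using that L(2) L(3)[of x] by (auto simp: flat_sphere_def)
  define u where "u x = L x /\<^sub>R N (L x)" for x
  have u_minus: "u (- x) = - u x" for x by (simp add: u_def linear_neg[OF L(1)] N)
  have u: "u x \<in> T" if "x \<in> flat_sphere k" for x
    using into[OF LV[OF that]] by (simp add: u_def)
  have L_cont: "continuous_on X L" for X by (intro linear_continuous_on linear_conv_bounded_linear[THEN iffD1] L)
  have NL_cont: "continuous_on X (\<lambda>x. N (L x))" for X
    by (rule continuous_on_compose2[OF N(1) L_cont]) auto
  have u_cont: "continuous_on (flat_sphere k) u"
    unfolding u_def by (intro continuous_intros L_cont NL_cont ballI pos LV)
  define G where "G x = (of_coords (f (u x)) :: 'a)" for x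
  have "continuous_map (top_of_set (flat_sphere k)) (top_of_set T) u"
    using u_cont u by (auto simp: image_subset_iff)
  then have "continuous_map (top_of_set (flat_sphere k)) (top_of_set (flat_sphere (Suc m)))
      ((of_coords :: _ \<Rightarrow> 'a) \<circ> (f \<circ> u))"
    by (rule continuous_map_compose[OF continuous_map_compose[OF _ f] continuous_map_of_coords[OF mD]])
  moreover have "of_coords \<circ> (f \<circ> u) = G" by (simp add: G_def fun_eq_iff)
  ultimately have "continuous_map (top_of_set (flat_sphere k)) (top_of_set (flat_sphere (Suc m))) G"
    by simp
  then have "continuous_on (flat_sphere k) G" "G \<in> flat_sphere k \<rightarrow> flat_sphere (Suc m)"
    by (auto simp: image_subset_iff_funcset)
  moreover have "G (- x) = - G x" if "x \<in> flat_sphere k" for x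
    by (simp add: G_def u_minus f_odd[OF u[OF that]] of_coords_minus)
  ultimately show False
    using Borsuk_Ulam_flat_sphere[OF k, of "Suc m" G] less m k_def by auto
qed

section \<open>The zeros of the two functionals\<close>

text \<open>Both functionals at once: \<open>s = - 1\<close> gives \<open>I\<close> and \<open>s = 1\<close> gives \<open>I\<^sup>+\<close>.\<close>

definition signed_tv :: "real \<Rightarrow> 'n::finite set set \<Rightarrow> real ^ 'n \<Rightarrow> real" where
  "signed_tv s E x = (\<Sum>(i, j) | {i, j} \<in> E. \<bar>x $ i + s * x $ j\<bar>) / 2"

lemma tv_eq_signed_tv: "tv = signed_tv (- 1)" "tv_plus = signed_tv 1"
  by (auto simp: fun_eq_iff tv_def tv_plus_def signed_tv_def)

text \<open>The zeros of \<open>signed_tv s E\<close>, cut down to the vectors without isolated vertices in their support.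
On these the weighted norm is a norm, and the coordinates at isolated vertices influence neither
\<open>signed_tv s E\<close> nor \<open>wnorm E\<close>.\<close>

definition null_space :: "real \<Rightarrow> 'n::finite set set \<Rightarrow> (real ^ 'n) set" where
  "null_space s E = {x. (\<forall>i j. {i, j} \<in> E \<longrightarrow> x $ i + s * x $ j = 0) \<and>
                        (\<forall>i. vdegree E i = 0 \<longrightarrow> x $ i = 0)}"

definition drop_isolated :: "'n::finite set set \<Rightarrow> real ^ 'n \<Rightarrow> real ^ 'n" where
  "drop_isolated E x = (\<chi> i. if vdegree E i = 0 then 0 else x $ i)"

lemma vdegree_eq_0_iff: "vdegree E i = 0 \<longleftrightarrow> (\<forall>e\<in>E. i \<notin> e)"
  by (auto simp: vdegree_def)

lemma signed_tv_eq_0_iff: "signed_tv s E x = 0 \<longleftrightarrow> (\<forall>i j. {i, j} \<in> E \<longrightarrow> x $ i + s * x $ j = 0)"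
  unfolding signed_tv_def by (auto simp: sum_nonneg_eq_0_iff case_prod_beta)

lemma signed_tv_nonneg: "0 \<le> signed_tv s E x"
  unfolding signed_tv_def by (auto intro!: sum_nonneg divide_nonneg_pos)

lemma continuous_on_signed_tv: "continuous_on X (signed_tv s E)"
  unfolding signed_tv_def case_prod_beta by (intro continuous_intros) auto

lemma continuous_on_wnorm: "continuous_on X (wnorm E)"
  unfolding wnorm_def by (intro continuous_intros)

lemma wnorm_nonneg: "0 \<le> wnorm E x"
  unfolding wnorm_def by (auto intro!: sum_nonneg)

lemma wnorm_scaleR: "wnorm E (c *\<^sub>R x) = \<bar>c\<bar> * wnorm E x"
  unfolding wnorm_def by (simp add: abs_mult sum_distrib_left mult.left_commute)

lemma wnorm_minus: "wnorm E (- x) = wnorm E x"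
  by (simp add: wnorm_def)

lemma zero_notin_wsphere: "0 \<notin> wsphere E"
  by (simp add: wsphere_def wnorm_def)

lemma subspace_null_space: "subspace (null_space s E)"
proof (rule subspaceI)
  fix x y :: "real ^ 'a" and c :: real
  assume x: "x \<in> null_space s E"
  show "c *\<^sub>R x \<in> null_space s E"
    using x by (auto simp: null_space_def mult.left_commute[of s] simp flip: distrib_left)
  assume y: "y \<in> null_space s E"
  have "x $ i + y $ i + s * (x $ j + y $ j) = 0" if "{i, j} \<in> E" for i j
  proof -
    have "x $ i + s * x $ j = 0" "y $ i + s * y $ j = 0"
      using x y that by (auto simp: null_space_def)
    then show ?thesis by (simp add: distrib_left)
  qed
  then show "x + y \<in> null_space s E" using x y by (simp add: null_space_def)
qed (simp add: null_space_def)

text \<open>At a vertex that is not isolated the degree is at least 1. The bound makes the weighted sphere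
bounded once isolated vertices are excluded.\<close>

lemma norm_le_wnorm:
  assumes "\<And>i. vdegree E i = 0 \<Longrightarrow> x $ i = 0"
  shows "norm x \<le> wnorm E x"
proof -
  have "\<bar>x $ i\<bar> \<le> real (vdegree E i) * \<bar>x $ i\<bar>" for i
  proof (cases "vdegree E i = 0")
    case False
    then have "1 \<le> real (vdegree E i)" by simp
    then show ?thesis using mult_right_mono[of 1 "real (vdegree E i)" "\<bar>x $ i\<bar>"] by simp
  qed (simp add: assms)
  then have "(\<Sum>i\<in>UNIV. \<bar>x $ i\<bar>) \<le> wnorm E x" unfolding wnorm_def by (intro sum_mono)
  then show ?thesis using norm_le_l1_cart[of x] by simp
qed

lemma wnorm_drop_isolated: "wnorm E (drop_isolated E x) = wnorm E x"
  unfolding wnorm_def drop_isolated_def by (intro sum.cong) auto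

lemma signed_tv_drop_isolated: "signed_tv s E (drop_isolated E x) = signed_tv s E x"
proof -
  have "drop_isolated E x $ i = x $ i" "drop_isolated E x $ j = x $ j" if "{i, j} \<in> E" for i j
    using that by (auto simp: drop_isolated_def vdegree_eq_0_iff)
  then show ?thesis
    unfolding signed_tv_def by (intro arg_cong[where f = "\<lambda>t. t / 2"] sum.cong) auto
qed

lemma inner_drop_isolated:
  assumes "y \<in> null_space s E"
  shows "drop_isolated E x \<bullet> y = x \<bullet> y"
  unfolding inner_vec_def using assms
  by (intro sum.cong) (auto simp: drop_isolated_def null_space_def)

lemma normalized_null_vector:
  assumes x: "x \<in> null_space s E" "x \<noteq> 0"
  shows "wnorm E x \<noteq> 0" "x /\<^sub>R wnorm E x \<in> {x \<in> wsphere E. signed_tv s E x = 0}"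
proof -
  have "norm x \<le> wnorm E x" using x by (intro norm_le_wnorm) (auto simp: null_space_def)
  then show pos: "wnorm E x \<noteq> 0" using x(2) by (metis norm_le_zero_iff)
  have "x /\<^sub>R wnorm E x \<in> null_space s E" by (rule subspace_scale[OF subspace_null_space x(1)])
  then have "signed_tv s E (x /\<^sub>R wnorm E x) = 0"
    by (simp only: signed_tv_eq_0_iff) (simp add: null_space_def)
  moreover have "wnorm E (x /\<^sub>R wnorm E x) = 1"
    using pos wnorm_nonneg[of E x] by (simp add: wnorm_scaleR)
  ultimately show "x /\<^sub>R wnorm E x \<in> {x \<in> wsphere E. signed_tv s E x = 0}"
    by (simp add: wsphere_def)
qed

lemma dim_null_space_le_genus:
  "dim (null_space s E) \<le> genus {x \<in> wsphere E. signed_tv s E x = 0}"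
proof (rule dim_le_genus[OF _ subspace_null_space, where N = "wnorm E"])
  show "0 \<notin> {x \<in> wsphere E. signed_tv s E x = 0}" using zero_notin_wsphere by blast
qed (fact continuous_on_wnorm wnorm_minus normalized_null_vector)+

text \<open>The inner products with the vectors of a basis of \<open>V\<close> do not vanish simultaneously on \<open>T\<close>.
As \<open>T\<close> is nonempty, the case \<open>dim V = 0\<close>, in which there is no sphere to map to, cannot occur.\<close>

lemma genus_le_dim:
  fixes T V :: "'a::euclidean_space set"
  assumes V: "subspace V" and "T \<noteq> {}" and ne: "\<And>x. x \<in> T \<Longrightarrow> \<exists>y\<in>V. x \<bullet> y \<noteq> 0"
  shows "genus T \<le> dim V"
proof -
  obtain B where B: "independent B" "span B = V" "card B = dim V"
    using basis_exists[of V] V by (metis span_subspace)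
  then have "finite B" by (simp add: independent_imp_finite)
  then obtain c where c: "bij_betw c {..<dim V} B"
    using ex_bij_betw_nat_finite[of B] B(3) by (auto simp: lessThan_atLeast0)
  have nz: "\<exists>i<dim V. x \<bullet> c i \<noteq> 0" if x: "x \<in> T" for x
  proof (rule ccontr)
    assume "\<not> ?thesis"
    then have "x \<bullet> b = 0" if "b \<in> B" for b
      using that c by (auto simp: bij_betw_def)
    then have "orthogonal x b" if "b \<in> B" for b
      using that by (simp add: orthogonal_def)
    then have "orthogonal x y" if "y \<in> span B" for y
      using that by (rule orthogonal_to_span[rotated])
    then have "x \<bullet> y = 0" if "y \<in> V" for y
      using that B(2) by (simp add: orthogonal_def)
    then show False using ne[OF x] by blast
  qed
  moreover have "1 \<le> dim V" using nz \<open>T \<noteq> {}\<close> by fastforce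
  ultimately show ?thesis by (intro genus_le[where c = c])
qed

text \<open>On the compact set of normalised vectors that are supported away from the isolated vertices and
orthogonal to the null space, \<open>signed_tv s E\<close> is positive, hence bounded below by some \<open>\<delta>\<close>. The
isolated coordinates of a point of the weighted sphere are unrestricted, but replacing them by 0
changes none of the quantities involved.\<close>

lemma small_signed_tv_not_orthogonal:
  "\<exists>\<delta>>0. \<forall>x\<in>wsphere E. signed_tv s E x < \<delta> \<longrightarrow> (\<exists>y\<in>null_space s E. x \<bullet> y \<noteq> 0)"
proof -
  define C where "C = {x. (\<forall>i. vdegree E i = 0 \<longrightarrow> x $ i = 0) \<and> wnorm E x = 1 \<and>
    (\<forall>y\<in>null_space s E. x \<bullet> y = 0)}"
  have "closed C"
    unfolding C_def Ball_def
    by (intro closed_Collect_conj closed_Collect_all closed_Collect_imp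
        closed_Collect_eq open_Collect_const continuous_intros continuous_on_wnorm)
  moreover have "bounded C"
    unfolding bounded_iff
    by (intro exI[of _ 1]) (metis (mono_tags, lifting) C_def mem_Collect_eq norm_le_wnorm)
  ultimately have C: "compact C" by (simp add: compact_eq_bounded_closed)
  have pos: "0 < signed_tv s E x" if "x \<in> C" for x
  proof -
    have "signed_tv s E x \<noteq> 0"
    proof
      assume "signed_tv s E x = 0"
      then have "x \<in> null_space s E" using that by (simp add: signed_tv_eq_0_iff null_space_def C_def)
      then have "x \<bullet> x = 0" using that unfolding C_def by blast
      then have "x = 0" by simp
      then show False using that zero_notin_wsphere[of E] by (simp add: C_def wsphere_def)
    qed
    then show ?thesis using signed_tv_nonneg[of s E x] by simp
  qed
  obtain \<delta> where \<delta>: "0 < \<delta>" "\<And>x. x \<in> C \<Longrightarrow> \<delta> \<le> signed_tv s E x"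
  proof (cases "C = {}")
    case True
    then show thesis using that[of 1] by simp
  next
    case False
    then obtain x0 where "x0 \<in> C" "\<And>x. x \<in> C \<Longrightarrow> signed_tv s E x0 \<le> signed_tv s E x"
      using continuous_attains_inf[OF C False continuous_on_signed_tv] by blast
    then show thesis using that pos by blast
  qed
  have "\<exists>y\<in>null_space s E. x \<bullet> y \<noteq> 0" if x: "x \<in> wsphere E" "signed_tv s E x < \<delta>" for x
  proof (rule ccontr)
    assume "\<not> ?thesis"
    then have "drop_isolated E x \<in> C"
      using x by (auto simp: C_def inner_drop_isolated wnorm_drop_isolated wsphere_def)
        (simp add: drop_isolated_def)
    then show False using \<delta>(2) x(2) signed_tv_drop_isolated[of s E x] by fastforce
  qed
  then show ?thesis using \<delta>(1) by blast
qed

section \<open>Comparing the two null spaces\<close>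

text \<open>A vector \<open>w\<close> with the largest possible support absorbs every other support: for all but finitely
many \<open>t\<close> the support of \<open>w + t *\<^sub>R x\<close> is the union of those of \<open>w\<close> and \<open>x\<close>.\<close>

lemma exists_maximal_support:
  fixes U :: "(real ^ 'n::finite) set"
  assumes U: "subspace U"
  shows "\<exists>w\<in>U. \<forall>x\<in>U. \<forall>i. x $ i \<noteq> 0 \<longrightarrow> w $ i \<noteq> 0"
proof -
  let ?s = "\<lambda>w. {i. w $ i \<noteq> (0::real)}"
  have "\<exists>w. w \<in> U \<and> (\<forall>x. x \<in> U \<longrightarrow> card (?s x) \<le> card (?s w))"
    by (rule ex_has_greatest_nat[of "\<lambda>w. w \<in> U" 0 _ "Suc CARD('n)"])
      (use subspace_0[OF U] in \<open>auto simp: card_mono less_Suc_eq_le\<close>)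
  then obtain w where w: "w \<in> U" "\<And>x. x \<in> U \<Longrightarrow> card (?s x) \<le> card (?s w)" by blast
  have "w $ i \<noteq> 0" if x: "x \<in> U" "x $ i \<noteq> 0" for x i
  proof
    assume wi: "w $ i = 0"
    \<comment> \<open>The finitely many values of \<open>t\<close> to avoid are 0 and those at which \<open>w\<close> and \<open>t *\<^sub>R x\<close> cancel in some coordinate.\<close>
    have "finite (insert 0 ((\<lambda>j. - (w $ j) / (x $ j)) ` UNIV))" by simp
    then obtain t where t: "t \<notin> insert 0 ((\<lambda>j. - (w $ j) / (x $ j)) ` UNIV)"
      using ex_new_if_finite infinite_UNIV_char_0 by blast
    let ?z = "w + t *\<^sub>R x"
    have "?z $ j \<noteq> 0" if "w $ j \<noteq> 0" for j
    proof (cases "x $ j = 0")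
      case False
      have "t \<noteq> - (w $ j) / (x $ j)" using t by auto
      then show ?thesis using False by (auto simp: field_simps add_eq_0_iff)
    qed (use that in simp)
    moreover have "?z $ i \<noteq> 0" using t wi x by simp
    ultimately have "?s w \<subset> ?s ?z" using wi by blast
    then have "card (?s w) < card (?s ?z)" by (intro psubset_card_mono) auto
    moreover have "?z \<in> U" using U w x by (intro subspace_add subspace_scale)
    ultimately show False using w(2)[of ?z] by simp
  qed
  then show ?thesis using w(1) by blast
qed

text \<open>Take \<open>w\<close> of maximal support in the null space of \<open>I\<^sup>+\<close>, so that \<open>w\<close> takes opposite
values at the ends of every edge.
If \<open>w\<close> vanishes at isolated vertices only, the signs of \<open>w\<close> are a bipartition. Otherwise
pointwise multiplication by \<open>w\<close> turns vectors with opposite values at the ends of the edges into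
vectors with equal ones. It is injective by the maximality of the support, and all vectors in its image vanish
at some vertex \<open>i0\<close> that is not isolated. The null space of \<open>I\<close> contains a vector that does not
vanish there, namely the indicator of the set of vertices that are not isolated, and so it has the
larger dimension.\<close>

lemma bipartite_if_dim_le:
  fixes E :: "'n::finite set set"
  assumes E: "simple_graph E" and dim: "dim (null_space (-1) E) \<le> dim (null_space 1 E)"
  shows "bipartite E"
proof -
  obtain w where w: "w \<in> null_space 1 E"
    and w_max: "\<And>x i. x \<in> null_space 1 E \<Longrightarrow> x $ i \<noteq> 0 \<Longrightarrow> w $ i \<noteq> 0"
    using exists_maximal_support[OF subspace_null_space] by blast
  have w_edge: "w $ i = - w $ j" if "{i, j} \<in> E" for i j
    using w that unfolding null_space_def by (auto simp: add_eq_0_iff2)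
  show ?thesis
  proof (cases "\<forall>i. vdegree E i \<noteq> 0 \<longrightarrow> w $ i \<noteq> 0")
    case True
    let ?A = "{i. 0 < w $ i}" and ?B = "{i. \<not> 0 < w $ i}"
    have "\<exists>a\<in>?A. \<exists>b\<in>?B. e = {a, b}" if e: "e \<in> E" for e
    proof -
      obtain i j where ij: "e = {i, j}" using E e unfolding simple_graph_def by blast
      moreover have "w $ i = - w $ j" using e w_edge unfolding ij by blast
      moreover have "w $ i \<noteq> 0" using e True unfolding ij vdegree_eq_0_iff by blast
      ultimately have "0 < w $ i \<and> \<not> 0 < w $ j \<or> 0 < w $ j \<and> \<not> 0 < w $ i" by linarith
      then show ?thesis
        unfolding ij by (metis (mono_tags, lifting) insert_commute mem_Collect_eq)
    qed
    then show ?thesis unfolding bipartite_def by (intro exI[of _ ?A] exI[of _ ?B]) auto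
  next
    case False
    then obtain i0 where i0: "vdegree E i0 \<noteq> 0" "w $ i0 = 0" by blast
    define M where "M x = (\<chi> i. x $ i * w $ i)" for x :: "real ^ 'n"
    have M: "linear M" by (rule linearI) (auto simp: M_def vec_eq_iff algebra_simps)
    have inj: "inj_on M (null_space 1 E)"
    proof (rule inj_onI)
      fix x y assume xy: "x \<in> null_space 1 E" "y \<in> null_space 1 E" "M x = M y"
      then have "x - y \<in> null_space 1 E" by (intro subspace_diff subspace_null_space)
      then have "(x - y) $ i \<noteq> 0 \<Longrightarrow> w $ i \<noteq> 0" for i by (rule w_max)
      moreover have "x $ i * w $ i = y $ i * w $ i" for i
        using xy(3) by (simp add: M_def vec_eq_iff)
      ultimately show "x = y" by (fastforce simp: vec_eq_iff)
    qed
    let ?U = "{z \<in> null_space (-1) E. z $ i0 = 0}"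
    have sub: "M ` null_space 1 E \<subseteq> ?U"
    proof
      fix z assume "z \<in> M ` null_space 1 E"
      then obtain x where x: "x \<in> null_space 1 E" "z = M x" by blast
      have "x $ i = - x $ j" if "{i, j} \<in> E" for i j
        using x that unfolding null_space_def by (auto simp: add_eq_0_iff2)
      then have "z $ i = z $ j" if "{i, j} \<in> E" for i j
        using w_edge[OF that] that by (simp add: x M_def)
      then show "z \<in> ?U" using x i0 by (auto simp: null_space_def M_def)
    qed
    have U: "subspace ?U"
      using subspace_null_space[of "-1" E] by (auto simp: subspace_def)
    let ?one = "(\<chi> i. if vdegree E i = 0 then 0 else 1) :: real ^ 'n"
    have "?one \<in> null_space (-1) E" by (auto simp: null_space_def vdegree_eq_0_iff)
    moreover have "?one \<notin> ?U" using i0 by simp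
    ultimately have "?U \<subset> null_space (-1) E" by blast
    then have "span ?U \<subset> span (null_space (-1) E)"
      using U subspace_null_space[of "-1" E] by (simp add: span_eq_iff[THEN iffD2])
    then have "dim ?U < dim (null_space (-1) E)" by (rule dim_psubset)
    moreover have "dim (null_space 1 E) = dim (M ` null_space 1 E)"
      using M inj subspace_null_space[of 1 E]
      by (metis dim_image_eq span_eq_iff)
    moreover have "dim (M ` null_space 1 E) \<le> dim ?U" using sub by (rule dim_subset)
    ultimately show ?thesis using dim by simp
  qed
qed

section \<open>Changing signs on one side of a bipartition\<close>

text \<open>For a bipartition with first part \<open>A\<close>, this involution interchanges the two functionals.\<close>

definition flip :: "'n::finite set \<Rightarrow> real ^ 'n \<Rightarrow> real ^ 'n" where
  "flip A x = (\<chi> i. if i \<in> A then x $ i else - x $ i)"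

lemma flip_flip [simp]: "flip A (flip A x) = x"
  by (simp add: flip_def vec_eq_iff)

lemma flip_arith: "flip A (- x) = - flip A x" "flip A (c *\<^sub>R x) = c *\<^sub>R flip A x"
  "flip A (x - y) = flip A x - flip A y"
  by (auto simp: flip_def vec_eq_iff)

lemma inner_flip: "flip A x \<bullet> y = x \<bullet> flip A y"
  unfolding inner_vec_def by (intro sum.cong) (auto simp: flip_def)

lemma continuous_on_flip: "continuous_on X (flip A)"
proof -
  have "continuous_on X (\<lambda>x. if i \<in> A then x $ i else - x $ i)" for i
    by (cases "i \<in> A") (auto intro!: continuous_intros)
  then show ?thesis unfolding flip_def by (rule continuous_on_vec_lambda)
qed

lemma flip_image_eq: "x \<in> flip A ` T \<longleftrightarrow> flip A x \<in> T"
  by (metis flip_flip image_iff)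

lemma flip_image_image [simp]: "flip A ` flip A ` T = T"
  by (simp add: image_image)

lemma wnorm_flip: "wnorm E (flip A x) = wnorm E x"
  unfolding wnorm_def by (intro sum.cong) (auto simp: flip_def)

lemma subdifferential_flip:
  assumes "\<And>y. F (flip A y) = F' y"
  shows "s \<in> subdifferential F (flip A x) \<longleftrightarrow> flip A s \<in> subdifferential F' x"
proof -
  have "F (flip A x) + s \<bullet> (flip A y - flip A x) \<le> F (flip A y) \<longleftrightarrow>
        F' x + flip A s \<bullet> (y - x) \<le> F' y" for y
    by (simp add: assms inner_flip flip_arith)
  then show ?thesis
    unfolding subdifferential_def mem_Collect_eq by (metis flip_flip)
qed

lemma eigenset_flip:
  assumes "\<And>y. F (flip A y) = F' y"
  shows "eigenset E F \<mu> = flip A ` eigenset E F' \<mu>"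
proof -
  have "eigenpair E F \<mu> (flip A x)" if x: "eigenpair E F' \<mu> x" and F: "\<And>y. F (flip A y) = F' y" for x F F'
  proof -
    obtain s where s: "s \<in> subdifferential (wnorm E) x" "\<mu> *\<^sub>R s \<in> subdifferential F' x"
      using x unfolding eigenpair_def by blast
    have "flip A s \<in> subdifferential (wnorm E) (flip A x)"
      using s(1) by (simp add: subdifferential_flip[where F' = "wnorm E"] wnorm_flip)
    moreover have "\<mu> *\<^sub>R flip A s \<in> subdifferential F (flip A x)"
      using s(2) by (simp add: subdifferential_flip[of F A F', OF F] flip_arith)
    ultimately show ?thesis
      using x unfolding eigenpair_def by (auto simp: wsphere_def wnorm_flip)
  qed
  from this[of F' _ F] this[of F _ F'] have "eigenpair E F \<mu> x \<longleftrightarrow> eigenpair E F' \<mu> (flip A x)" for x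
    using assms by (metis flip_flip)
  then show ?thesis
    by (auto simp: eigenset_def flip_image_eq)
qed

lemma odd_map_to_sphere_flip:
  assumes "odd_map_to_sphere T k"
  shows "odd_map_to_sphere (flip A ` T) k"
proof -
  obtain f where f: "continuous_map (top_of_set T) (nsphere (k - 1)) f"
    "\<And>x. x \<in> T \<Longrightarrow> f (- x) = (\<lambda>i. - f x i)"
    using assms unfolding odd_map_to_sphere_def by blast
  have "continuous_map (top_of_set (flip A ` T)) (top_of_set T) (flip A)"
    by (auto simp: continuous_on_flip)
  then have "continuous_map (top_of_set (flip A ` T)) (nsphere (k - 1)) (f \<circ> flip A)"
    using f(1) by (rule continuous_map_compose)
  moreover have "(f \<circ> flip A) (- x) = (\<lambda>i. - (f \<circ> flip A) x i)" if "x \<in> flip A ` T" for x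
    using f(2) that by (auto simp: flip_arith)
  ultimately show ?thesis unfolding odd_map_to_sphere_def by blast
qed

lemma genus_flip: "genus (flip A ` T) = genus T"
proof -
  have "odd_map_to_sphere (flip A ` T) k \<longleftrightarrow> odd_map_to_sphere T k" for k
    using odd_map_to_sphere_flip[of T k A] odd_map_to_sphere_flip[of "flip A ` T" k A] by auto
  then show ?thesis by (simp add: genus_def)
qed

lemma minmax_flip_le:
  assumes F: "\<And>y. F (flip A y) = F' y"
  shows "minmax E F k \<le> minmax E F' k"
  unfolding minmax_def
proof (rule INF_mono)
  fix T assume T: "T \<in> {T. T \<noteq> {} \<and> T \<subseteq> wsphere E \<and> uminus ` T = T \<and> k \<le> genus T}"
  have "uminus ` flip A ` T = flip A ` uminus ` T"
    by (simp add: image_image flip_arith)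
  then have "flip A ` T \<in> {T. T \<noteq> {} \<and> T \<subseteq> wsphere E \<and> uminus ` T = T \<and> k \<le> genus T}"
    using T by (auto simp: genus_flip wsphere_def wnorm_flip)
  moreover have "(SUP x\<in>flip A ` T. ereal (F x)) \<le> (SUP x\<in>T. ereal (F' x))"
    by (simp add: image_image F)
  ultimately show "\<exists>S\<in>{T. T \<noteq> {} \<and> T \<subseteq> wsphere E \<and> uminus ` T = T \<and> k \<le> genus T}.
      (SUP x\<in>S. ereal (F x)) \<le> (SUP x\<in>T. ereal (F' x))" by blast
qed

lemma bipartite_flip:
  assumes "bipartite E"
  shows "\<exists>A. \<forall>x. tv_plus E (flip A x) = tv E x"
proof -
  obtain A B where "A \<union> B = UNIV \<and> A \<inter> B = {} \<and> (\<forall>e\<in>E. \<exists>a\<in>A. \<exists>b\<in>B. e = {a, b})"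
    using assms unfolding bipartite_def by (elim exE)
  then have AB: "A \<inter> B = {}" "\<forall>e\<in>E. \<exists>a\<in>A. \<exists>b\<in>B. e = {a, b}" by simp_all
  have "tv_plus E (flip A x) = tv E x" for x
    unfolding tv_plus_def tv_def
  proof (intro arg_cong[where f = "\<lambda>t. t / 2"] sum.cong refl, clarify)
    fix i j assume "{i, j} \<in> E"
    then have "i \<in> A \<and> j \<notin> A \<or> i \<notin> A \<and> j \<in> A"
      using AB(1) bspec[OF AB(2), of "{i, j}"] by (auto simp: doubleton_eq_iff)
    then show "\<bar>flip A x $ i + flip A x $ j\<bar> = \<bar>x $ i - x $ j\<bar>"
      by (auto simp: flip_def)
  qed
  then show ?thesis by blast
qed

section \<open>The eigenvalue 0 and the vanishing min-max values\<close>

text \<open>The eigenvalue 0 scales the subdifferential of the weighted norm to \<open>{0}\<close>, provided that this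
subdifferential is nonempty.\<close>

lemma wnorm_subgradient: "(\<chi> i. real (vdegree E i) * sgn (x $ i)) \<in> subdifferential (wnorm E) x"
proof -
  have "wnorm E x + (\<chi> i. real (vdegree E i) * sgn (x $ i)) \<bullet> (y - x) \<le> wnorm E y" for y
  proof -
    have "wnorm E x + (\<chi> i. real (vdegree E i) * sgn (x $ i)) \<bullet> (y - x)
        = (\<Sum>i\<in>UNIV. real (vdegree E i) * (sgn (x $ i) * y $ i))"
      unfolding wnorm_def inner_vec_def sum.distrib[symmetric]
      by (intro sum.cong) (auto simp: abs_sgn algebra_simps)
    also have "\<dots> \<le> wnorm E y"
      unfolding wnorm_def by (intro sum_mono mult_left_mono) (auto simp: sgn_if)
    finally show ?thesis .
  qed
  then show ?thesis by (simp add: subdifferential_def)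
qed

text \<open>A nonnegative functional that vanishes somewhere has 0 as a subgradient exactly at its zeros.\<close>

lemma eigenset_0: "eigenset E (signed_tv s E) 0 = {x \<in> wsphere E. signed_tv s E x = 0}"
proof -
  have "signed_tv s E 0 = 0" by (simp add: signed_tv_def)
  then have "0 \<in> subdifferential (signed_tv s E) x \<longleftrightarrow> signed_tv s E x = 0" for x
    using signed_tv_nonneg[of s E] by (auto simp: subdifferential_def intro: antisym) (metis antisym)
  moreover have "(\<lambda>s. 0 *\<^sub>R s) ` subdifferential (wnorm E) x = {0}" for x
    using wnorm_subgradient[of E x] by auto
  ultimately show ?thesis by (auto simp: eigenset_def eigenpair_def)
qed

text \<open>The indicator of the set of vertices that are not isolated is annihilated by \<open>I\<close>, and it is
nonzero as soon as there is an edge.\<close>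

lemma dim_null_space_pos:
  assumes "E \<noteq> {}" "simple_graph E"
  shows "1 \<le> dim (null_space (- 1) E)"
proof -
  obtain e where "e \<in> E" using assms(1) by blast
  then obtain i j where ij: "{i, j} \<in> E" using assms(2) unfolding simple_graph_def by metis
  let ?one = "(\<chi> i. if vdegree E i = 0 then 0 else 1) :: real ^ 'a"
  have "?one \<in> null_space (-1) E" by (auto simp: null_space_def vdegree_eq_0_iff)
  moreover have "vdegree E i \<noteq> 0" using ij by (auto simp: vdegree_eq_0_iff)
  then have "?one \<noteq> 0" by (auto simp: vec_eq_iff)
  ultimately have "\<not> null_space (-1) E \<subseteq> {0}" by blast
  then have "dim (null_space (-1) E) \<noteq> 0" unfolding dim_eq_0 .
  then show ?thesis by linarith
qed

lemma signed_tv_minus: "signed_tv s E (- x) = signed_tv s E x"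
proof -
  have "\<bar>- a + s * - b\<bar> = \<bar>a + s * b\<bar>" for a b :: real
    by (metis abs_minus_cancel minus_add_distrib mult_minus_right)
  then show ?thesis by (simp only: signed_tv_def vector_uminus_component)
qed

lemma kernel_nonempty:
  assumes "1 \<le> dim (null_space s E)"
  shows "{x \<in> wsphere E. signed_tv s E x = 0} \<noteq> {}"
proof -
  have "dim (null_space s E) \<noteq> 0" using assms by linarith
  then obtain x where "x \<in> null_space s E" "x \<noteq> 0" unfolding dim_eq_0 by blast
  then show ?thesis using normalized_null_vector(2) by blast
qed

text \<open>The same \<open>\<delta>\<close> serves all sublevel sets, which is what bounds the min-max values away from 0.\<close>

lemma genus_le_dim_null_space:
  "\<exists>\<delta>>0. \<forall>T. T \<noteq> {} \<longrightarrow> T \<subseteq> wsphere E \<longrightarrow> (\<forall>x\<in>T. signed_tv s E x < \<delta>) \<longrightarrow>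
    genus T \<le> dim (null_space s E)"
proof -
  obtain \<delta> where \<delta>: "0 < \<delta>"
      "\<forall>x\<in>wsphere E. signed_tv s E x < \<delta> \<longrightarrow> (\<exists>y\<in>null_space s E. x \<bullet> y \<noteq> 0)"
    using small_signed_tv_not_orthogonal[of E s] by blast
  have "genus T \<le> dim (null_space s E)"
    if "T \<noteq> {}" "T \<subseteq> wsphere E" "\<forall>x\<in>T. signed_tv s E x < \<delta>" for T
  proof (rule genus_le_dim[OF subspace_null_space that(1)])
    show "\<exists>y\<in>null_space s E. x \<bullet> y \<noteq> 0" if "x \<in> T" for x
      using \<delta>(2) that \<open>T \<subseteq> wsphere E\<close> \<open>\<forall>x\<in>T. signed_tv s E x < \<delta>\<close> by blast
  qed
  then show ?thesis using \<delta>(1) by blast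
qed

text \<open>The eigenset contains the weighted sphere of the null space and lies in every sublevel set of
\<open>signed_tv s E\<close> of positive level.\<close>

lemma genus_eigenset_0:
  assumes "eigenset E (signed_tv s E) 0 \<noteq> {}"
  shows "genus (eigenset E (signed_tv s E) 0) = dim (null_space s E)"
proof (rule antisym)
  obtain \<delta> where \<delta>: "0 < \<delta>" and small: "\<forall>T. T \<noteq> {} \<longrightarrow> T \<subseteq> wsphere E \<longrightarrow>
      (\<forall>x\<in>T. signed_tv s E x < \<delta>) \<longrightarrow> genus T \<le> dim (null_space s E)"
    using genus_le_dim_null_space[of E s] by blast
  show "genus (eigenset E (signed_tv s E) 0) \<le> dim (null_space s E)"
    by (rule small[rule_format, OF assms]) (use \<delta> in \<open>auto simp: eigenset_0\<close>)
  show "dim (null_space s E) \<le> genus (eigenset E (signed_tv s E) 0)"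
    unfolding eigenset_0 by (rule dim_null_space_le_genus)
qed

text \<open>For \<open>k\<close> up to the dimension of the null space the zero set itself is admissible. Beyond it, no
admissible set fits into a sublevel set of small level.\<close>

lemma minmax_le_0_iff:
  assumes "1 \<le> k"
  shows "minmax E (signed_tv s E) k \<le> 0 \<longleftrightarrow> k \<le> dim (null_space s E)"
proof
  let ?K = "{x \<in> wsphere E. signed_tv s E x = 0}"
  assume k: "k \<le> dim (null_space s E)"
  have "minmax E (signed_tv s E) k \<le> (SUP x\<in>?K. ereal (signed_tv s E x))"
    unfolding minmax_def
  proof (rule INF_lower)
    have sym: "- x \<in> ?K" if "x \<in> ?K" for x
      using that by (simp add: wsphere_def wnorm_minus signed_tv_minus)
    have "x \<in> uminus ` ?K" if "x \<in> ?K" for x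
      using imageI[OF sym[OF that], of uminus] by simp
    then have "uminus ` ?K = ?K" using sym by blast
    moreover have "?K \<noteq> {}" by (rule kernel_nonempty) (use assms k in linarith)
    moreover have "k \<le> genus ?K" using k dim_null_space_le_genus[of s E] by linarith
    ultimately show "?K \<in> {T. T \<noteq> {} \<and> T \<subseteq> wsphere E \<and> uminus ` T = T \<and> k \<le> genus T}"
      by blast
  qed
  also have "\<dots> \<le> 0" by (rule SUP_least) simp
  finally show "minmax E (signed_tv s E) k \<le> 0" .
next
  assume le0: "minmax E (signed_tv s E) k \<le> 0"
  show "k \<le> dim (null_space s E)"
  proof (rule ccontr)
    assume k: "\<not> k \<le> dim (null_space s E)"
    obtain \<delta> where \<delta>: "0 < \<delta>" and small: "\<forall>T. T \<noteq> {} \<longrightarrow> T \<subseteq> wsphere E \<longrightarrow>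
        (\<forall>x\<in>T. signed_tv s E x < \<delta>) \<longrightarrow> genus T \<le> dim (null_space s E)"
      using genus_le_dim_null_space[of E s] by blast
    have "ereal \<delta> \<le> minmax E (signed_tv s E) k"
      unfolding minmax_def
    proof (rule INF_greatest)
      fix T assume T: "T \<in> {T. T \<noteq> {} \<and> T \<subseteq> wsphere E \<and> uminus ` T = T \<and> k \<le> genus T}"
      then have "\<not> genus T \<le> dim (null_space s E)" using k by auto
      then have "\<not> (\<forall>x\<in>T. signed_tv s E x < \<delta>)" using small T by blast
      then obtain x where x: "x \<in> T" "\<delta> \<le> signed_tv s E x" by (auto simp: not_less)
      then have "ereal \<delta> \<le> ereal (signed_tv s E x)" by simp
      also have "\<dots> \<le> (SUP x\<in>T. ereal (signed_tv s E x))" using x(1) by (rule SUP_upper)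
      finally show "ereal \<delta> \<le> (SUP x\<in>T. ereal (signed_tv s E x))" .
    qed
    then have "ereal \<delta> \<le> 0" using le0 by (rule order_trans)
    then show False using \<delta> by simp
  qed
qed

lemma bipartite_imp_same_invariants:
  assumes "bipartite E"
  shows "spectrum1 E (tv_plus E) = spectrum1 E (tv E)"
    and "multiplicity_genus E (tv_plus E) \<mu> = multiplicity_genus E (tv E) \<mu>"
    and "minmax E (tv_plus E) k = minmax E (tv E) k"
proof -
  obtain A where A: "\<forall>x. tv_plus E (flip A x) = tv E x" using bipartite_flip[OF assms] by blast
  have A': "tv E (flip A x) = tv_plus E x" for x using A[rule_format, of "flip A x"] by simp
  have K: "eigenset E (tv_plus E) \<mu> = flip A ` eigenset E (tv E) \<mu>" for \<mu>
    using A[rule_format] by (rule eigenset_flip)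
  show "spectrum1 E (tv_plus E) = spectrum1 E (tv E)"
    using K by (auto simp: spectrum1_def eigenset_def set_eq_iff)
  show "multiplicity_genus E (tv_plus E) \<mu> = multiplicity_genus E (tv E) \<mu>"
    by (simp add: multiplicity_genus_def K genus_flip)
  show "minmax E (tv_plus E) k = minmax E (tv E) k"
    using minmax_flip_le[of "tv_plus E" A "tv E" E k, OF A[rule_format]]
      minmax_flip_le[of "tv E" A "tv_plus E" E k, OF A'] by (rule antisym)
qed

lemma bipartite_empty: "bipartite {}"
  unfolding bipartite_def by (rule exI[of _ UNIV], rule exI[of _ "{}"]) simp

theorem theorem2p7:
  fixes E :: "'n::finite set set"
  assumes "simple_graph E"
  shows "(bipartite E \<longleftrightarrow>
            spectrum1 E (tv_plus E) = spectrum1 E (tv E) \<and>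
            (\<forall>\<mu>\<in>spectrum1 E (tv E).
               multiplicity_genus E (tv_plus E) \<mu> = multiplicity_genus E (tv E) \<mu>)) \<and>
         (bipartite E \<longleftrightarrow>
            (\<forall>k\<in>{1..CARD('n)}. minmax E (tv_plus E) k = minmax E (tv E) k))"
proof -
  let ?d = "dim (null_space (- 1) E)" and ?d' = "dim (null_space 1 E)"
  have spectrum: "spectrum1 E F = {\<mu>. eigenset E F \<mu> \<noteq> {}}" for F
    by (auto simp: spectrum1_def eigenset_def)
  have bipartiteI: "bipartite E" if "E \<noteq> {} \<Longrightarrow> ?d \<le> ?d'"
    using that bipartite_if_dim_le[OF assms] bipartite_empty by (cases "E = {}") auto
  have "bipartite E"
    if b: "spectrum1 E (tv_plus E) = spectrum1 E (tv E)"
      "\<forall>\<mu>\<in>spectrum1 E (tv E). multiplicity_genus E (tv_plus E) \<mu> = multiplicity_genus E (tv E) \<mu>"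
  proof (rule bipartiteI)
    assume "E \<noteq> {}"
    then have ne: "eigenset E (tv E) 0 \<noteq> {}"
      unfolding tv_eq_signed_tv eigenset_0
      using assms by (intro kernel_nonempty dim_null_space_pos)
    then have 0: "0 \<in> spectrum1 E (tv E)" by (simp add: spectrum)
    then have ne': "eigenset E (tv_plus E) 0 \<noteq> {}"
      using b(1) unfolding spectrum by blast
    have "genus (eigenset E (tv_plus E) 0) = genus (eigenset E (tv E) 0)"
      using b(2) 0 unfolding multiplicity_genus_def by blast
    then show "?d \<le> ?d'"
      using ne ne' unfolding tv_eq_signed_tv by (simp add: genus_eigenset_0)
  qed
  moreover have "bipartite E"
    if c: "\<forall>k\<in>{1..CARD('n)}. minmax E (tv_plus E) k = minmax E (tv E) k"
  proof (rule bipartiteI)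
    assume "E \<noteq> {}"
    then have d: "1 \<le> ?d" using assms by (rule dim_null_space_pos)
    then have "minmax E (tv_plus E) ?d = minmax E (tv E) ?d"
      using c dim_subset_UNIV_cart[of "null_space (- 1) E"] by auto
    then show "?d \<le> ?d'"
      unfolding tv_eq_signed_tv using minmax_le_0_iff[OF d, of E] by (metis order_refl)
  qed
  ultimately show ?thesis using bipartite_imp_same_invariants[of E] by blast
qed

end
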